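(* If $(a,b)$ is a maximal gap in the Lagrange spectrum $\mathbb{L}$, then there exists an eventually periodic doubly infinite sequence $A$ of positive integers such that $a=\lambda_0(A)=M(A)$. In particular, $a$ is a sum of two quadratic irrationalities.
   Context: For real irrational $\alpha$, $\mu(\alpha)^{-1}=\liminf_{q\to\infty,\ q\in\mathbb{N},\ p\in\mathbb{Z}}|q(q\alpha-p)|$, and the Lagrange spectrum $\mathbb{L}$ is the set of all finite values of $\mu(\alpha)$. A maximal gap of $\mathbb{L}$ is an open interval $(a,b)$ with $a,b\in\mathbb{L}$ and $(a,b)\cap\mathbb{L}=\emptyset$. For a doubly infinite sequence $A=(\ldots,a_{-1},a_0,a_1,\ldots)$ of positive integers and $i\in\mathbb{Z}$, set $\lambda_i(A)=[a_i;a_{i-1},a_{i-2},\ldots]+[0;a_{i+1},a_{i+2},\ldots]$ and $M(A)=\sup_{i\in\mathbb{Z}}\lambda_i(A)$. $A$ is eventually periodic if there is an integer $n$ such that both one-sided sequences $a_n,a_{n+1},\ldots$ and $a_{-n},a_{-n-1},\ldots$ are periodic (the two periods need not coincide). *)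

theory Defs
  imports "HOL-Library.Extended_Real"
begin

text \<open>The filter \<open>sequentially \<times>\<^sub>F top\<close> on pairs \<open>(q, p)\<close> expresses
  \<open>q \<rightarrow> \<infinity>\<close> with \<open>p\<close> unrestricted. In \<^typ>\<open>ereal\<close>, \<open>inverse 0 = \<infinity>\<close>, so
  \<open>\<mu>(\<alpha>) = \<infinity>\<close> when the lower limit vanishes.\<close>

definition lagrange_mu :: "real \<Rightarrow> ereal" where
  "lagrange_mu \<alpha> = inverse (Liminf (sequentially \<times>\<^sub>F top)
     (\<lambda>(q :: nat, p :: int). ereal \<bar>real q * (real q * \<alpha> - real_of_int p)\<bar>))"

definition lagrange_spectrum :: "real set" where
  "lagrange_spectrum = {x. \<exists>\<alpha>. \<alpha> \<notin> \<rat> \<and> lagrange_mu \<alpha> = ereal x}"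

definition maximal_gap :: "real set \<Rightarrow> real \<Rightarrow> real \<Rightarrow> bool" where
  "maximal_gap S a b \<longleftrightarrow> a < b \<and> a \<in> S \<and> b \<in> S \<and> {a<..<b} \<inter> S = {}"

text \<open>\<open>cf_convergent n c\<close> is the finite continued fraction \<open>[c 0; c 1, \<dots>, c n]\<close>.\<close>

primrec cf_convergent :: "nat \<Rightarrow> (nat \<Rightarrow> nat) \<Rightarrow> real" where
  "cf_convergent 0 c = real (c 0)"
| "cf_convergent (Suc n) c = real (c 0) + 1 / cf_convergent n (\<lambda>k. c (Suc k))"

text \<open>The limit exists whenever \<open>c n > 0\<close> for all \<open>n \<ge> 1\<close>; only such \<open>c\<close> are of interest.\<close>

definition cf_value :: "(nat \<Rightarrow> nat) \<Rightarrow> real" where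
  "cf_value c = lim (\<lambda>n. cf_convergent n c)"

definition bi_lambda :: "(int \<Rightarrow> nat) \<Rightarrow> int \<Rightarrow> real" where
  "bi_lambda A i = cf_value (\<lambda>n. A (i - int n))
     + cf_value (\<lambda>n. if n = 0 then 0 else A (i + int n))"

text \<open>The supremum is taken in \<^typ>\<open>ereal\<close>, since it is infinite for unbounded sequences.\<close>

definition bi_M :: "(int \<Rightarrow> nat) \<Rightarrow> ereal" where
  "bi_M A = (SUP i. ereal (bi_lambda A i))"

definition periodic_seq :: "(nat \<Rightarrow> 'a) \<Rightarrow> bool" where
  "periodic_seq s \<longleftrightarrow> (\<exists>t>0. \<forall>k. s (k + t) = s k)"

definition eventually_periodic :: "(int \<Rightarrow> 'a) \<Rightarrow> bool" where
  "eventually_periodic A \<longleftrightarrow>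
     (\<exists>n :: int. periodic_seq (\<lambda>k. A (n + int k)) \<and> periodic_seq (\<lambda>k. A (- n - int k)))"

definition quadratic_irrational :: "real \<Rightarrow> bool" where
  "quadratic_irrational x \<longleftrightarrow> x \<notin> \<rat> \<and>
     (\<exists>a b c :: int. a \<noteq> 0 \<and> of_int a * x\<^sup>2 + of_int b * x + of_int c = 0)"

end

theory Submission
  imports Defs "HOL-Analysis.Extended_Real_Limits"
begin

text \<open>Perron's formula identifies \<open>L\<close> with the set of finite values of
  \<open>limsup\<^sub>n \<lambda>\<^sub>n(A)\<close> over positive bi-infinite sequences \<open>A\<close>. Choose \<open>A\<close> with value \<open>a\<close> and a window
  length so large that a window determines \<open>\<lambda>\<close> of its middle up to an error smaller than the gap,
  and let \<open>C\<close> be the set of bi-infinite sequences all of whose windows occur infinitely often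
  in \<open>A\<close>. Then \<open>\<lambda>\<^sub>i(X) < b\<close> for \<open>X \<in> C\<close>. Any finite block of \<open>X \<in> C\<close> can be closed up inside \<open>C\<close>
  to a periodic sequence \<open>P\<close>; as \<open>M(P)\<close> lies in \<open>L\<close> and below \<open>b\<close>, the gap forces
  \<open>M(P) \<le> a\<close>, and hence \<open>\<lambda>\<^sub>i(X) \<le> a\<close> for all \<open>X \<in> C\<close>. Conversely, given its central window,
  the element of \<open>C\<close> maximising \<open>\<lambda>\<^sub>0\<close> is found greedily, by appending alternately the smallest and
  the largest admissible letter on either side. The greedy choice depends only on a window and a
  parity, so it is eventually periodic, and for a suitable central window it reaches \<open>a\<close>.\<close>

subsection \<open>Continued fractions\<close>

text \<open>For \<open>n > 0\<close> this is the finite fraction [0; x 0, ..., x (n-1) + t]. The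
  free last argument turns cutting an infinite fraction after \<open>n\<close> letters into an exact
  equation.\<close>

primrec cf_tail :: "nat \<Rightarrow> (nat \<Rightarrow> nat) \<Rightarrow> real \<Rightarrow> real" where
  "cf_tail 0 x t = t"
| "cf_tail (Suc n) x t = 1 / (real (x 0) + cf_tail n (\<lambda>k. x (Suc k)) t)"

text \<open>The infinite fraction [0; x 0, x 1, ...] without integer part, so that both halves of
  \<open>bi_lambda\<close> become values of one function.\<close>

definition cf_frac :: "(nat \<Rightarrow> nat) \<Rightarrow> real" where
  "cf_frac x = lim (\<lambda>n. cf_tail n x 0)"

lemma cf_tail_add: "cf_tail (m + n) x t = cf_tail m x (cf_tail n (\<lambda>k. x (m + k)) t)"
  by (induction m arbitrary: x) simp_all

lemma cf_tail_cong: "(\<And>k. k < n \<Longrightarrow> x k = y k) \<Longrightarrow> cf_tail n x t = cf_tail n y t"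
proof (induction n arbitrary: x y)
  case (Suc n)
  have "cf_tail n (\<lambda>k. x (Suc k)) t = cf_tail n (\<lambda>k. y (Suc k)) t"
    by (rule Suc.IH) (simp add: Suc.prems)
  with Suc.prems[of 0] show ?case by simp
qed simp

lemma cf_tail_bounds:
  assumes "\<forall>k. 0 < x k" "0 \<le> t" "t \<le> 1"
  shows "0 \<le> cf_tail n x t \<and> cf_tail n x t \<le> 1"
  using assms
proof (induction n arbitrary: x)
  case (Suc n)
  have "0 \<le> cf_tail n (\<lambda>k. x (Suc k)) t" using Suc by simp
  moreover have "1 \<le> real (x 0)" using Suc.prems(1) by (metis Suc_leI One_nat_def of_nat_1 of_nat_mono)
  ultimately show ?case by simp
qed simp

text \<open>The difference equals (u - v) / (U V) with both factors at least 2. A single step has no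
  uniform contraction factor, since 1 / (1 + r) has slope -1 at r = 0; two steps together gain a
  factor 4.\<close>

lemma two_step_contraction:
  fixes a b u v :: real
  assumes "1 \<le> a" "1 \<le> b" "0 \<le> u" "0 \<le> v"
  shows "\<bar>1 / (a + 1 / (b + u)) - 1 / (a + 1 / (b + v))\<bar> \<le> \<bar>u - v\<bar> / 4"
proof -
  define U where "U = a * (b + u) + 1"
  define V where "V = a * (b + v) + 1"
  have "1 * 1 \<le> a * (b + u)" "1 * 1 \<le> a * (b + v)" using assms by (intro mult_mono; simp)+
  then have UV: "2 \<le> U" "2 \<le> V" by (simp_all add: U_def V_def)
  have eq: "1 / (a + 1 / (b + w)) = (b + w) / (a * (b + w) + 1)" if "0 \<le> w" for w
    using assms(1,2) that by (simp add: field_simps)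
  have "1 / (a + 1 / (b + u)) - 1 / (a + 1 / (b + v)) = (b + u) / U - (b + v) / V"
    using eq assms by (simp add: U_def V_def)
  also have "\<dots> = (u - v) / (U * V)"
    using UV by (simp add: divide_simps) (simp add: U_def V_def algebra_simps)
  finally have "\<bar>1 / (a + 1 / (b + u)) - 1 / (a + 1 / (b + v))\<bar> = \<bar>u - v\<bar> / (U * V)"
    using UV by (simp add: abs_divide abs_mult)
  also have "\<dots> \<le> \<bar>u - v\<bar> / (2 * 2)"
    using UV by (intro divide_left_mono mult_mono mult_pos_pos) auto
  finally show ?thesis by simp
qed

text \<open>Induction in steps of two, each gaining 1/4. The factor 2 is what the case
  \<open>n = 1\<close> requires, where only the trivial bound 1 is available.\<close>

lemma cf_tail_contraction:
  assumes "\<forall>k. 0 < x k" "0 \<le> s" "s \<le> 1" "0 \<le> t" "t \<le> 1"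
  shows "\<bar>cf_tail n x s - cf_tail n x t\<bar> \<le> 2 * (1 / 2) ^ n"
  using assms
proof (induction n arbitrary: x rule: induct_nat_012)
  case 1
  show ?case
    using cf_tail_bounds[OF 1(1,2,3), of 1] cf_tail_bounds[OF 1(1,4,5), of 1]
    by (simp del: cf_tail.simps add: abs_le_iff)
next
  case (ge2 n)
  let ?y = "\<lambda>k. x (Suc (Suc k))"
  have y: "\<forall>k. 0 < ?y k" using ge2.prems by simp
  have ge: "1 \<le> real (x k)" for k
    using ge2.prems(1) by (metis Suc_leI One_nat_def of_nat_1 of_nat_mono)
  have "\<bar>cf_tail (Suc (Suc n)) x s - cf_tail (Suc (Suc n)) x t\<bar> \<le> \<bar>cf_tail n ?y s - cf_tail n ?y t\<bar> / 4"
    using two_step_contraction[OF ge ge] cf_tail_bounds[OF y ge2.prems(2,3)]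
      cf_tail_bounds[OF y ge2.prems(4,5)] by simp
  also have "\<dots> \<le> 2 * (1 / 2) ^ n / 4"
    using ge2.IH(1)[OF y ge2.prems(2-5)] by simp
  finally show ?case by simp
qed auto

lemma cf_tail_agree:
  assumes "\<forall>k. 0 < x k" "\<forall>k. 0 < y k" "\<And>k. k < n \<Longrightarrow> x k = y k"
    and "0 \<le> s" "s \<le> 1" "0 \<le> t" "t \<le> 1"
  shows "\<bar>cf_tail n x s - cf_tail n y t\<bar> \<le> 2 * (1 / 2) ^ n"
  using cf_tail_contraction[OF assms(1,4-7), of n] cf_tail_cong[of n x y t] assms(3) by simp

text \<open>Each map r to 1 / (a + r) reverses the order, so the parity of the number of steps
  decides.\<close>

lemma cf_tail_alternating:
  assumes "\<forall>k. 0 < x k" "0 \<le> s" "s \<le> t"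
  shows "if even n then cf_tail n x s \<le> cf_tail n x t else cf_tail n x t \<le> cf_tail n x s"
  using assms(1)
proof (induction n arbitrary: x)
  case (Suc n)
  let ?y = "\<lambda>k. x (Suc k)"
  have nonneg: "0 \<le> cf_tail n z r" if "0 \<le> r" for r and z :: "nat \<Rightarrow> nat"
    using that by (induction n arbitrary: z) simp_all
  have "0 < real (x 0) + cf_tail n ?y s" "0 < real (x 0) + cf_tail n ?y t"
    using Suc.prems nonneg assms by (simp_all add: add_pos_nonneg)
  then show ?case
    using Suc.IH[of ?y] Suc.prems by (auto intro!: divide_left_mono mult_pos_pos split: if_splits)
qed (use assms in simp)

lemma small_power_half:
  fixes e :: real assumes "0 < e" shows "\<exists>n. 2 * (1 / 2) ^ n < e"
proof -
  obtain n where "(1 / 2) ^ n < e / 2" using real_arch_pow_inv[of "e / 2" "1 / 2"] assms by auto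
  then have "2 * (1 / 2) ^ n < e" by (simp only: less_divide_eq_numeral1 mult.commute)
  then show ?thesis ..
qed

text \<open>All truncations beyond stage \<open>N\<close> share the outer map
  \<open>cf_tail N x\<close> and differ only in its argument, so the contraction gives the Cauchy
  property.\<close>

lemma cf_frac_LIMSEQ:
  assumes "\<forall>k. 0 < x k" shows "(\<lambda>n. cf_tail n x 0) \<longlonglongrightarrow> cf_frac x"
proof -
  have "Cauchy (\<lambda>n. cf_tail n x 0)"
  proof (rule metric_CauchyI)
    fix e :: real assume "0 < e"
    then obtain N where N: "2 * (1 / 2) ^ N < e" using small_power_half by blast
    have "dist (cf_tail m x 0) (cf_tail n x 0) < e" if mn: "N \<le> m" "N \<le> n" for m n
    proof -
      let ?y = "\<lambda>k. x (N + k)"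
      have eq: "cf_tail l x 0 = cf_tail N x (cf_tail (l - N) ?y 0)" if "N \<le> l" for l
        using cf_tail_add[of N "l - N"] that by simp
      have "\<bar>cf_tail N x (cf_tail (m - N) ?y 0) - cf_tail N x (cf_tail (n - N) ?y 0)\<bar> \<le> 2 * (1 / 2) ^ N"
        using assms by (intro cf_tail_contraction) (simp_all add: cf_tail_bounds)
      then show ?thesis using N mn eq by (simp add: dist_real_def)
    qed
    then show "\<exists>N. \<forall>m\<ge>N. \<forall>n\<ge>N. dist (cf_tail m x 0) (cf_tail n x 0) < e" by blast
  qed
  then show ?thesis
    unfolding cf_frac_def by (simp add: Cauchy_convergent_iff convergent_LIMSEQ_iff)
qed

lemma cf_frac_unit:
  assumes "\<forall>k. 0 < x k" shows "0 \<le> cf_frac x" "cf_frac x \<le> 1"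
  using LIMSEQ_le_const[OF cf_frac_LIMSEQ[OF assms]] LIMSEQ_le_const2[OF cf_frac_LIMSEQ[OF assms]]
    cf_tail_bounds[OF assms] by (meson order_refl zero_le_one)+

lemma cf_frac_rec:
  assumes "\<forall>k. 0 < x k" shows "cf_frac x = 1 / (real (x 0) + cf_frac (\<lambda>k. x (Suc k)))"
proof -
  let ?y = "\<lambda>k. x (Suc k)"
  have "\<forall>k. 0 < ?y k" using assms by simp
  moreover from this have "real (x 0) + cf_frac ?y \<noteq> 0"
    using assms cf_frac_unit(1)[of ?y] by (metis add_pos_nonneg less_irrefl of_nat_0_less_iff)
  ultimately have "(\<lambda>n. cf_tail (Suc n) x 0) \<longlonglongrightarrow> 1 / (real (x 0) + cf_frac ?y)"
    unfolding cf_tail.simps by (intro tendsto_intros cf_frac_LIMSEQ) auto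
  with LIMSEQ_Suc[OF cf_frac_LIMSEQ[OF assms]] show ?thesis by (rule LIMSEQ_unique)
qed

lemma cf_frac_bounds:
  assumes "\<forall>k. 0 < x k" shows "0 < cf_frac x" "cf_frac x < 1"
proof -
  have pos: "0 < cf_frac y" if "\<forall>k. 0 < y k" for y
    using cf_frac_rec[OF that] cf_frac_unit(1)[of "\<lambda>k. y (Suc k)"] that
    by (metis add_pos_nonneg of_nat_0_less_iff zero_less_divide_1_iff)
  show "0 < cf_frac x" by (rule pos[OF assms])
  have "1 \<le> real (x 0)" using assms by (metis Suc_leI One_nat_def of_nat_1 of_nat_mono)
  moreover have "0 < cf_frac (\<lambda>k. x (Suc k))" using pos assms by simp
  ultimately show "cf_frac x < 1" by (subst cf_frac_rec[OF assms]) simp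
qed

lemma cf_frac_unfold:
  assumes "\<forall>k. 0 < x k" shows "cf_frac x = cf_tail n x (cf_frac (\<lambda>k. x (n + k)))"
  using assms
proof (induction n arbitrary: x)
  case (Suc n)
  show ?case using Suc.IH[of "\<lambda>k. x (Suc k)"] Suc.prems cf_frac_rec[OF Suc.prems] by simp
qed simp

lemma cf_frac_agree:
  assumes "\<forall>k. 0 < x k" "\<forall>k. 0 < y k" "\<And>k. k < n \<Longrightarrow> x k = y k"
  shows "\<bar>cf_frac x - cf_frac y\<bar> \<le> 2 * (1 / 2) ^ n"
proof -
  have "\<forall>k. 0 < x (n + k)" "\<forall>k. 0 < y (n + k)" using assms by auto
  then show ?thesis
    unfolding cf_frac_unfold[OF assms(1), of n] cf_frac_unfold[OF assms(2), of n]
    by (intro cf_tail_agree assms cf_frac_unit)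
qed

text \<open>Tails lie in [0, 1], so at the first disagreement the larger letter gives the smaller
  (or equal) remaining fraction. The common letters in front then reverse the order once
  each.\<close>

lemma cf_frac_alternating:
  assumes x: "\<forall>k. 0 < x k" and y: "\<forall>k. 0 < y k" and agree: "\<And>k. k < n \<Longrightarrow> x k = y k"
    and less: "if even n then x n < y n else y n < x n"
  shows "cf_frac y \<le> cf_frac x"
proof -
  have aux: "cf_frac w \<le> cf_frac v"
    if "\<forall>k. 0 < v k" "\<forall>k. 0 < w k" "v 0 < w 0" for v w
  proof -
    have "real (v 0) + cf_frac (\<lambda>k. v (Suc k)) \<le> real (w 0) + cf_frac (\<lambda>k. w (Suc k))"
      using cf_frac_unit(2)[of "\<lambda>k. v (Suc k)"] cf_frac_unit(1)[of "\<lambda>k. w (Suc k)"] that by auto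
    moreover have "0 < real (v 0) + cf_frac (\<lambda>k. v (Suc k))"
      using cf_frac_unit(1)[of "\<lambda>k. v (Suc k)"] that by (simp add: add_pos_nonneg)
    ultimately show ?thesis
      unfolding cf_frac_rec[OF that(1)] cf_frac_rec[OF that(2)] by (intro divide_left_mono) auto
  qed
  let ?x = "\<lambda>k. x (n + k)" and ?y = "\<lambda>k. y (n + k)"
  have pos: "\<forall>k. 0 < ?x k" "\<forall>k. 0 < ?y k" using x y by auto
  have eq: "cf_frac x = cf_tail n x (cf_frac ?x)" "cf_frac y = cf_tail n x (cf_frac ?y)"
    using cf_frac_unfold[OF x, of n] cf_frac_unfold[OF y, of n] cf_tail_cong[of n x y] agree by auto
  show ?thesis
  proof (cases "even n")
    case True
    then have "cf_frac ?y \<le> cf_frac ?x" using aux[of ?x ?y] pos less by simp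
    then show ?thesis
      using cf_tail_alternating[OF x cf_frac_unit(1)[OF pos(2)], of "cf_frac ?x" n] True eq by simp
  next
    case False
    then have "cf_frac ?x \<le> cf_frac ?y" using aux[of ?y ?x] pos less by simp
    then show ?thesis
      using cf_tail_alternating[OF x cf_frac_unit(1)[OF pos(1)], of "cf_frac ?y" n] False eq by simp
  qed
qed

text \<open>Euclid's descent: a value p/q forces p < q, and then the tail is (q - x 0 p) / p, a
  fraction with the smaller denominator p.\<close>

lemma cf_frac_irrational:
  assumes "\<forall>k. 0 < x k" shows "cf_frac x \<notin> \<rat>"
proof -
  have "cf_frac x \<noteq> real p / real q" for p q
    using assms
  proof (induction q arbitrary: p x rule: less_induct)
    case (less q)
    show ?case
    proof
      assume eq: "cf_frac x = real p / real q"
      let ?y = "\<lambda>k. x (Suc k)"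
      have y: "\<forall>k. 0 < ?y k" using less.prems by simp
      have q: "0 < q" and p: "0 < p"
        using cf_frac_bounds[OF less.prems] eq by (auto intro!: Nat.gr0I)
      then have pq: "p < q"
        using cf_frac_bounds(2)[OF less.prems] eq by (simp add: divide_less_eq)
      have "real p / real q = 1 / (real (x 0) + cf_frac ?y)"
        using cf_frac_rec[OF less.prems] eq by simp
      then have e: "cf_frac ?y = (real q - real (x 0) * real p) / real p"
        using p q cf_frac_bounds(1)[OF y] by (simp add: field_simps)
      then have "real (x 0 * p) \<le> real q"
        using cf_frac_unit(1)[OF y] p by (simp add: zero_le_divide_iff)
      then have "x 0 * p \<le> q" by linarith
      then have "cf_frac ?y = real (q - x 0 * p) / real p" using e by (simp add: of_nat_diff)
      then show False using less.IH[OF pq y] by blast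
    qed
  qed
  moreover have "0 \<le> cf_frac x" using cf_frac_unit(1)[OF assms] .
  ultimately show ?thesis by (metis Rats_abs_nat_div_natE abs_of_nonneg)
qed

section \<open>Values of bi-infinite sequences\<close>

lemma cf_value_eq:
  assumes "\<forall>k. 0 < c (Suc k)" shows "cf_value c = real (c 0) + cf_frac (\<lambda>k. c (Suc k))"
proof -
  have eq: "cf_convergent n d = real (d 0) + cf_tail n (\<lambda>k. d (Suc k)) 0" for n d
    by (induction n arbitrary: d) simp_all
  have "(\<lambda>n. cf_convergent n c) \<longlonglongrightarrow> real (c 0) + cf_frac (\<lambda>k. c (Suc k))"
    unfolding eq using assms by (intro tendsto_intros cf_frac_LIMSEQ)
  then show ?thesis unfolding cf_value_def by (rule limI)
qed

lemma bi_lambda_eq: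
  assumes "\<forall>i. 0 < A i"
  shows "bi_lambda A i = real (A i) + cf_frac (\<lambda>k. A (i - 1 - int k)) + cf_frac (\<lambda>k. A (i + 1 + int k))"
  using assms unfolding bi_lambda_def
  by (subst (1 2) cf_value_eq) (simp_all add: algebra_simps)

lemma bi_lambda_agree:
  assumes "\<forall>i. 0 < A i" "\<forall>i. 0 < B i" "\<And>k. \<bar>k\<bar> \<le> int n \<Longrightarrow> A (i + k) = B (j + k)"
  shows "\<bar>bi_lambda A i - bi_lambda B j\<bar> \<le> 4 * (1 / 2) ^ n"
proof -
  have "\<bar>cf_frac (\<lambda>k. A (i - 1 - int k)) - cf_frac (\<lambda>k. B (j - 1 - int k))\<bar> \<le> 2 * (1 / 2) ^ n"
  proof (rule cf_frac_agree)
    fix k assume "k < n"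
    then show "A (i - 1 - int k) = B (j - 1 - int k)" using assms(3)[of "- 1 - int k"] by (simp add: algebra_simps)
  qed (use assms in auto)
  moreover have "\<bar>cf_frac (\<lambda>k. A (i + 1 + int k)) - cf_frac (\<lambda>k. B (j + 1 + int k))\<bar> \<le> 2 * (1 / 2) ^ n"
  proof (rule cf_frac_agree)
    fix k assume "k < n"
    then show "A (i + 1 + int k) = B (j + 1 + int k)" using assms(3)[of "1 + int k"] by (simp add: algebra_simps)
  qed (use assms in auto)
  moreover have "A i = B j" using assms(3)[of 0] by simp
  ultimately show ?thesis unfolding bi_lambda_eq[OF assms(1)] bi_lambda_eq[OF assms(2)] by linarith
qed

subsection \<open>Perron's formula\<close>

text \<open>Continuants with the index shifted by one:
  \<open>cf_num x (Suc n) / cf_den x (Suc n)\<close> is the convergent using \<open>n\<close>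
  letters, and index 0 is the formal convergent 1/0.\<close>

fun cf_num :: "(nat \<Rightarrow> nat) \<Rightarrow> nat \<Rightarrow> nat" where
  "cf_num x 0 = 1"
| "cf_num x (Suc 0) = 0"
| "cf_num x (Suc (Suc n)) = x n * cf_num x (Suc n) + cf_num x n"

fun cf_den :: "(nat \<Rightarrow> nat) \<Rightarrow> nat \<Rightarrow> nat" where
  "cf_den x 0 = 0"
| "cf_den x (Suc 0) = 1"
| "cf_den x (Suc (Suc n)) = x n * cf_den x (Suc n) + cf_den x n"

lemma cf_den_pos: "\<forall>k. 0 < x k \<Longrightarrow> 0 < cf_den x (Suc n)"
  by (induction n) simp_all

lemma cf_den_mono: "\<forall>k. 0 < x k \<Longrightarrow> cf_den x n \<le> cf_den x (Suc n)"
proof (induction n)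
  case (Suc n)
  from Suc.prems have "1 \<le> x n" by (simp add: Suc_le_eq)
  then have "1 * cf_den x (Suc n) \<le> x n * cf_den x (Suc n)" by (rule mult_right_mono) simp
  then show ?case unfolding cf_den.simps(3) by linarith
qed simp

lemma cf_den_ge: "\<forall>k. 0 < x k \<Longrightarrow> n \<le> cf_den x (Suc n)"
proof (induction n rule: induct_nat_012)
  case (ge2 n)
  have "cf_den x (Suc (Suc n)) + 1 \<le> x (Suc n) * cf_den x (Suc (Suc n)) + cf_den x (Suc n)"
    using ge2.prems cf_den_pos[of x n] by (intro add_mono) (auto simp: Suc_le_eq)
  then show ?case using ge2 by simp
qed (simp_all add: Suc_le_eq)

lemma cf_num_den_det:
  "int (cf_num x (Suc n)) * int (cf_den x n) - int (cf_num x n) * int (cf_den x (Suc n)) = (- 1) ^ Suc n"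
  by (induction n) (simp_all add: algebra_simps)

text \<open>\<open>cf_tail n x\<close> is a Moebius map in \<open>t\<close>, and the continuants are
  the entries of its matrix.\<close>

lemma cf_tail_eq:
  assumes "\<forall>k. 0 < x k" "0 \<le> t"
  shows "cf_tail n x t = (real (cf_num x (Suc n)) + t * real (cf_num x n)) /
    (real (cf_den x (Suc n)) + t * real (cf_den x n))"
  using assms(2)
proof (induction n arbitrary: t)
  case (Suc n)
  have pos: "0 < real (x n) + t" using assms Suc.prems by (simp add: add_pos_nonneg)
  \<comment> \<open>The last letter is peeled off, not the first, because the continuants grow by
    appending letters at the end.\<close>
  have "cf_tail (Suc n) x t = cf_tail n x (1 / (real (x n) + t))"
    using cf_tail_add[of n 1] by simp
  also have "\<dots> = (real (cf_num x (Suc n)) + 1 / (real (x n) + t) * real (cf_num x n)) /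
      (real (cf_den x (Suc n)) + 1 / (real (x n) + t) * real (cf_den x n))"
    using pos by (intro Suc.IH) simp
  also have "\<dots> = (real (cf_num x (Suc (Suc n))) + t * real (cf_num x (Suc n))) /
      (real (cf_den x (Suc (Suc n))) + t * real (cf_den x (Suc n)))"
  proof -
    have "(h1 + 1 / r * h0) / (k1 + 1 / r * k0) = (r * h1 + h0) / (r * k1 + k0)"
      if "0 < r" for h0 h1 k0 k1 r :: real
    proof -
      have "h1 + 1 / r * h0 = (r * h1 + h0) / r" "k1 + 1 / r * k0 = (r * k1 + k0) / r"
        using that by (simp_all add: field_simps)
      then show ?thesis using that by simp
    qed
    from this[OF pos] show ?thesis by (simp add: algebra_simps)
  qed
  finally show ?case .
qed simp

definition cf_err :: "(nat \<Rightarrow> nat) \<Rightarrow> nat \<Rightarrow> real" where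
  "cf_err x n = real (cf_den x n) * cf_frac x - real (cf_num x n)"

text \<open>In terms of letters this is [x n; x (n+1), ...] + [0; x (n-1), ..., x 0], the one-sided
  counterpart of \<open>bi_lambda\<close>, cut off at index 0.\<close>

definition cf_lambda :: "(nat \<Rightarrow> nat) \<Rightarrow> nat \<Rightarrow> real" where
  "cf_lambda x n = 1 / cf_frac (\<lambda>k. x (n + k)) + real (cf_den x n) / real (cf_den x (Suc n))"

text \<open>The value of the fraction is the Moebius image of its tail \<open>t\<close>; the
  determinant is a sign, so the error collapses to a signed t / (k1 + t k0).\<close>

lemma cf_err_eq:
  assumes "\<forall>k. 0 < x k"
  shows "cf_err x (Suc n) = (- 1) ^ n / (real (cf_den x (Suc n)) * cf_lambda x n)"
    and "0 < cf_lambda x n"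
proof -
  define t where "t = cf_frac (\<lambda>k. x (n + k))"
  define k0 k1 h0 h1 where kh: "k0 = real (cf_den x n)" "k1 = real (cf_den x (Suc n))"
    "h0 = real (cf_num x n)" "h1 = real (cf_num x (Suc n))"
  have t: "0 < t" unfolding t_def using assms by (intro cf_frac_bounds) auto
  have k: "0 < k1" "0 \<le> k0" using cf_den_pos assms kh by auto
  have lam: "cf_lambda x n = (k1 + t * k0) / (t * k1)"
    using t k unfolding cf_lambda_def kh(1,2)[symmetric] t_def[symmetric] by (simp add: field_simps)
  have pos: "0 < k1 + t * k0" using t k by (simp add: add_pos_nonneg)
  have "cf_frac x = (h1 + t * h0) / (k1 + t * k0)"
    using cf_frac_unfold[OF assms, of n] cf_tail_eq[OF assms, of t n] t by (simp add: t_def kh)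
  then have "cf_err x (Suc n) = k1 * ((h1 + t * h0) / (k1 + t * k0)) - h1"
    by (simp add: cf_err_def kh)
  also have "\<dots> = - t * (h1 * k0 - h0 * k1) / (k1 + t * k0)"
    using pos by (simp add: field_simps)
  also have "h1 * k0 - h0 * k1 = (- 1) ^ Suc n"
    using arg_cong[OF cf_num_den_det[of x n], of real_of_int] by (simp add: kh)
  finally show "cf_err x (Suc n) = (- 1) ^ n / (real (cf_den x (Suc n)) * cf_lambda x n)"
    using t k unfolding lam kh(2)[symmetric] by simp
  show "0 < cf_lambda x n" using pos t k unfolding lam by simp
qed

lemma cf_err_abs:
  assumes "\<forall>k. 0 < x k"
  shows "real (cf_den x (Suc n)) * \<bar>cf_err x (Suc n)\<bar> = 1 / cf_lambda x n"
  using cf_err_eq[OF assms, of n] cf_den_pos[OF assms, of n] by (simp add: abs_mult)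

text \<open>With \<open>s\<close> the ratio of consecutive denominators and \<open>t\<close> the tail, two consecutive values are
  \<open>1/s + t\<close> and \<open>1/t + s\<close>, whose sum is at least 4.\<close>

lemma cf_lambda_ge_2:
  assumes "\<forall>k. 0 < x k" shows "2 \<le> cf_lambda x n \<or> 2 \<le> cf_lambda x (Suc n)"
proof -
  define s where "s = real (cf_den x (Suc n)) / real (cf_den x (Suc (Suc n)))"
  define t where "t = cf_frac (\<lambda>k. x (Suc n + k))"
  have s: "0 < s" using cf_den_pos assms unfolding s_def by (simp del: cf_den.simps)
  have t: "0 < t" unfolding t_def using assms by (intro cf_frac_bounds) auto
  have "1 / cf_frac (\<lambda>k. x (n + k)) = real (x n) + t"
    using cf_frac_rec[of "\<lambda>k. x (n + k)"] assms by (simp add: t_def)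
  moreover have "1 / s = real (x n) + real (cf_den x n) / real (cf_den x (Suc n))"
    using cf_den_pos[OF assms, of n] by (simp add: s_def field_simps)
  ultimately have l1: "cf_lambda x n = 1 / s + t" unfolding cf_lambda_def by simp
  have l2: "cf_lambda x (Suc n) = 1 / t + s" unfolding cf_lambda_def s_def t_def ..
  have amgm: "2 \<le> 1 / r + r" if "0 < r" for r :: real
    using that sum_squares_bound[of 1 r] by (simp add: field_simps power2_eq_square)
  show ?thesis using amgm[OF s] amgm[OF t] l1 l2 by linarith
qed

text \<open>Denominators grow at least linearly, so there is a greatest index with denominator at
  most \<open>q\<close>. The greatest one is taken because the first two denominators coincide when
  \<open>x 0 = 1\<close>.\<close>

lemma cf_den_bracket:
  assumes "\<forall>k. 0 < x k" "0 < q"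
  obtains n where "cf_den x (Suc n) \<le> q" "q < cf_den x (Suc (Suc n))"
proof -
  let ?P = "\<lambda>n. cf_den x (Suc n) \<le> q"
  have bound: "\<forall>n. ?P n \<longrightarrow> n \<le> q" using cf_den_ge[OF assms(1)] order_trans by blast
  have "?P 0" using assms(2) by simp
  then have "?P (Greatest ?P)" "\<not> ?P (Suc (Greatest ?P))"
    using GreatestI_nat[of ?P 0 q] Greatest_le_nat[of ?P "Suc (Greatest ?P)" q] bound
    by (blast, metis Suc_n_not_le_n)
  then show ?thesis using that by (meson not_le)
qed

text \<open>Expand \<open>(q, p)\<close> in the basis of two consecutive convergents. The coefficients have opposite
  signs, and so have the errors, so nothing cancels unless \<open>(q, p)\<close> is a multiple of a convergent.\<close>

lemma approximation_dichotomy: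
  assumes x: "\<forall>k. 0 < x k" and q: "cf_den x (Suc n) \<le> q" "q < cf_den x (Suc (Suc n))"
  shows "1 / cf_lambda x n \<le> real q * \<bar>real q * cf_frac x - real_of_int p\<bar> \<or>
    1 / 2 \<le> real q * \<bar>real q * cf_frac x - real_of_int p\<bar>"
proof -
  define K0 K1 H0 H1 where KH: "K0 = int (cf_den x (Suc n))" "K1 = int (cf_den x (Suc (Suc n)))"
    "H0 = int (cf_num x (Suc n))" "H1 = int (cf_num x (Suc (Suc n)))"
  define \<epsilon> :: int where "\<epsilon> = (- 1) ^ n"
  define Q where "Q = int q"
  have eps: "\<epsilon> * \<epsilon> = 1" by (simp add: \<epsilon>_def flip: power_mult_distrib)
  have det: "H1 * K0 - H0 * K1 = \<epsilon>"
    using cf_num_den_det[of x "Suc n"] by (simp add: KH \<epsilon>_def del: cf_num.simps cf_den.simps)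
  \<comment> \<open>Cramer's rule for the coordinates of \<open>(q, p)\<close>: the determinant
    \<epsilon> is a sign, its own inverse, so the coordinates are integers.\<close>
  define u where "u = \<epsilon> * (H1 * Q - K1 * p)"
  define v where "v = \<epsilon> * (K0 * p - H0 * Q)"
  have Qeq: "Q = u * K0 + v * K1"
  proof -
    have "u * K0 + v * K1 = \<epsilon> * (H1 * K0 - H0 * K1) * Q" by (simp add: u_def v_def algebra_simps)
    then show ?thesis using det eps by simp
  qed
  have peq: "p = u * H0 + v * H1"
  proof -
    have "u * H0 + v * H1 = \<epsilon> * (H1 * K0 - H0 * K1) * p" by (simp add: u_def v_def algebra_simps)
    then show ?thesis using det eps by simp
  qed
  have K0: "0 < K0" using cf_den_pos[OF x, of n] by (simp add: KH)
  have QK: "K0 \<le> Q" "Q < K1" using q unfolding KH Q_def by (simp_all only: of_nat_le_iff of_nat_less_iff)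
  let ?e0 = "cf_err x (Suc n)" and ?e1 = "cf_err x (Suc (Suc n))"
  let ?E = "real q * cf_frac x - real_of_int p"
  have Rq: "real q = real_of_int u * real_of_int K0 + real_of_int v * real_of_int K1"
    using arg_cong[OF Qeq, of real_of_int] by (simp add: Q_def)
  have Rp: "real_of_int p = real_of_int u * real_of_int H0 + real_of_int v * real_of_int H1"
    using arg_cong[OF peq, of real_of_int] by simp
  have e0: "?e0 = real_of_int K0 * cf_frac x - real_of_int H0"
    and e1: "?e1 = real_of_int K1 * cf_frac x - real_of_int H1"
    by (simp_all add: cf_err_def KH)
  have E: "?E = real_of_int u * ?e0 + real_of_int v * ?e1"
    unfolding e0 e1 Rq Rp by (simp add: algebra_simps)
  have opp: "?e0 * ?e1 \<le> 0"
  proof -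
    have "?e0 * ?e1 = (-1) ^ n * (-1) ^ Suc n / (real (cf_den x (Suc n)) * cf_lambda x n *
        (real (cf_den x (Suc (Suc n))) * cf_lambda x (Suc n)))"
      unfolding cf_err_eq(1)[OF x] by (simp del: cf_den.simps)
    also have "(-1) ^ n * (-1) ^ Suc n = (-1::real)" by (simp flip: power_mult_distrib)
    finally show ?thesis
      using cf_err_eq(2)[OF x] by (simp del: cf_den.simps add: divide_le_0_iff less_imp_le)
  qed
  show ?thesis
  \<comment> \<open>Here \<open>(q, p)\<close> is \<open>u\<close> times a convergent and the
    product is multiplied by the square of \<open>u\<close>.\<close>
  proof (cases "v = 0")
    case True
    then have "0 < u" using Qeq QK K0 by (simp add: zero_less_mult_iff)
    then have u: "1 \<le> real_of_int u" by simp
    have "1 * 1 \<le> real_of_int u * real_of_int u" using u by (intro mult_mono) auto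
    then have "1 / cf_lambda x n \<le> (real_of_int u * real_of_int u) * (1 / cf_lambda x n)"
      using mult_right_mono[of 1 "real_of_int u * real_of_int u" "1 / cf_lambda x n"]
        cf_err_eq(2)[OF x, of n] by simp
    also have "\<dots> = real q * \<bar>?E\<bar>"
      using E True u Rq by (simp add: cf_err_abs[OF x, symmetric] abs_mult KH)
    finally show ?thesis ..
  next
    case False
    have uv: "(u < 0 \<and> 0 < v) \<or> (0 < u \<and> v < 0)"
    proof (cases "0 < v")
      case True
      then have "K1 \<le> v * K1" using QK K0 by (simp add: mult_le_cancel_right1)
      then have "u * K0 < 0" using Qeq QK by linarith
      then show ?thesis using True K0 by (simp add: mult_less_0_iff)
    next
      case v: False
      then have "v * K1 < 0" using False QK K0 by (simp add: mult_less_0_iff)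
      then have "0 < u * K0" using Qeq QK K0 by linarith
      then show ?thesis using v False K0 by (simp add: zero_less_mult_iff)
    qed
    have "\<bar>?E\<bar> = \<bar>real_of_int u * ?e0\<bar> + \<bar>real_of_int v * ?e1\<bar>"
    proof -
      have "0 \<le> (real_of_int u * real_of_int v) * (?e0 * ?e1)"
        using opp uv by (intro mult_nonpos_nonpos) (auto simp: mult_le_0_iff)
      then have "0 \<le> (real_of_int u * ?e0) * (real_of_int v * ?e1)" by (simp add: ac_simps)
      moreover have "\<bar>a + b\<bar> = \<bar>a\<bar> + \<bar>b\<bar>" if "0 \<le> a * b" for a b :: real
        using that unfolding zero_le_mult_iff by linarith
      ultimately show ?thesis unfolding E by blast
    qed
    moreover have "1 * \<bar>?e0\<bar> \<le> \<bar>real_of_int u\<bar> * \<bar>?e0\<bar>"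
      using uv by (intro mult_right_mono) auto
    ultimately have best: "\<bar>?e0\<bar> \<le> \<bar>?E\<bar>" by (simp add: abs_mult add_increasing2)
    \<comment> \<open>A nonzero \<open>v\<close> makes this integer determinant at least 1 in
      absolute value. Written through the two errors it is at most twice
      \<open>real q * \<bar>?E\<bar>\<close>, whence the bound 1/2.\<close>
    have "v = \<epsilon> * (K0 * p - H0 * Q)" by (rule v_def)
    then have "K0 * p - H0 * Q \<noteq> 0" using False by auto
    then have "1 \<le> \<bar>real_of_int (K0 * p - H0 * Q)\<bar>" by linarith
    also have "real_of_int (K0 * p - H0 * Q) = real q * ?e0 - real_of_int K0 * ?E"
      by (simp add: e0 Q_def algebra_simps)
    also have "\<bar>\<dots>\<bar> \<le> real q * \<bar>?e0\<bar> + real_of_int K0 * \<bar>?E\<bar>"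
      using K0 by (intro order_trans[OF abs_triangle_ineq4]) (simp add: abs_mult)
    also have "\<dots> \<le> real q * \<bar>?E\<bar> + real q * \<bar>?E\<bar>"
      using best QK(1) by (intro add_mono mult_left_mono mult_right_mono) (auto simp: Q_def)
    finally show ?thesis by simp
  qed
qed

section \<open>The lower limit over all fractions as an upper limit along the expansion\<close>

lemma eventually_sequentially_times_top:
  "eventually P (sequentially \<times>\<^sub>F (top :: 'a filter)) \<longleftrightarrow> (\<exists>N. \<forall>n\<ge>N. \<forall>p. P (n, p))"
proof
  assume "\<exists>N. \<forall>n\<ge>N. \<forall>p. P (n, p)"
  then show "eventually P (sequentially \<times>\<^sub>F (top :: 'a filter))"
  proof
    fix N assume "\<forall>n\<ge>N. \<forall>p. P (n, p)"
    then show ?thesis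
      unfolding eventually_prod_filter eventually_sequentially eventually_top
      by (intro exI[of _ "\<lambda>n. N \<le> n"] exI[of _ "\<lambda>_. True"]) auto
  qed
next
  assume "eventually P (sequentially \<times>\<^sub>F (top :: 'a filter))"
  then show "\<exists>N. \<forall>n\<ge>N. \<forall>p. P (n, p)"
    unfolding eventually_prod_filter eventually_sequentially eventually_top by blast
qed

text \<open>Convergents realise the values 1 / \<open>cf_lambda\<close>, which gives one inequality.
  For the other, every pair is at least as bad as some late convergent or has product at least
  1/2.\<close>

lemma lagrange_mu_cf_lambda:
  assumes x: "\<forall>k. 0 < x k"
  shows "lagrange_mu (cf_frac x) = limsup (\<lambda>n. ereal (cf_lambda x n))"
proof -
  let ?F = "sequentially \<times>\<^sub>F (top :: int filter)"
  let ?f = "\<lambda>(q :: nat, p :: int). ereal \<bar>real q * (real q * cf_frac x - real_of_int p)\<bar>"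
  let ?d = "\<lambda>n. ereal (1 / cf_lambda x n)"
  have lam: "0 < cf_lambda x n" for n using cf_err_eq(2)[OF x] .
  have f: "?f (q, p) = ereal (real q * \<bar>real q * cf_frac x - real_of_int p\<bar>)" for q p
    by (simp add: abs_mult)
  have "Liminf ?F ?f \<le> liminf ?d"
    unfolding le_Liminf_iff[of _ sequentially]
  proof (intro allI impI)
    fix y assume "y < Liminf ?F ?f"
    then have "eventually (\<lambda>z. y < ?f z) ?F" by (rule less_LiminfD)
    then obtain N where N: "\<And>q p. N \<le> q \<Longrightarrow> y < ?f (q, p)"
      unfolding eventually_sequentially_times_top by blast
    have "y < ?d n" if "N \<le> n" for n
    proof -
      have "?f (cf_den x (Suc n), int (cf_num x (Suc n))) = ?d n"
        unfolding f using cf_err_abs[OF x, of n] by (simp add: cf_err_def)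
      then show ?thesis
        using N[of "cf_den x (Suc n)" "int (cf_num x (Suc n))"] cf_den_ge[OF x, of n] that by simp
    qed
    then show "\<forall>\<^sub>F n in sequentially. y < ?d n" unfolding eventually_sequentially by blast
  qed
  moreover have "liminf ?d \<le> Liminf ?F ?f"
    unfolding le_Liminf_iff[of _ ?F]
  proof (intro allI impI)
    fix y assume "y < liminf ?d"
    then obtain N where N: "\<And>n. N \<le> n \<Longrightarrow> y < ?d n"
      using less_LiminfD[of y sequentially ?d] unfolding eventually_sequentially by blast
    \<comment> \<open>Values at least 2 recur for ever, so a \<open>y\<close> eventually below the
      reciprocals is below 1/2; this settles the second alternative of the dichotomy.\<close>
    obtain m where m: "N \<le> m" "2 \<le> cf_lambda x m"
      using cf_lambda_ge_2[OF x, of N] by (meson le_SucI order_refl)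
    have "?d m \<le> ereal (1 / 2)" using m(2) lam[of m] by (simp add: field_simps)
    with N[OF m(1)] have half: "y < ereal (1 / 2)" by (rule less_le_trans)
    have "y < ?f (q, p)" if q: "cf_den x (Suc N) \<le> q" for q p
    proof -
      have "0 < q" using q cf_den_pos[OF x, of N] by simp
      then obtain n where n: "cf_den x (Suc n) \<le> q" "q < cf_den x (Suc (Suc n))"
        using cf_den_bracket[OF x] by blast
      have "N \<le> n"
      proof (rule ccontr)
        assume "\<not> N \<le> n"
        then have "Suc (Suc n) \<le> Suc N" by simp
        then have "cf_den x (Suc (Suc n)) \<le> cf_den x (Suc N)"
          by (rule lift_Suc_mono_le[of "cf_den x", OF cf_den_mono[OF x]])
        then show False using q n by linarith
      qed
      then show ?thesis
        using approximation_dichotomy[OF x n, of p] N[of n] half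
        unfolding f by (meson ereal_less_eq(3) less_le_trans)
    qed
    then show "eventually (\<lambda>z. y < ?f z) ?F"
      unfolding eventually_sequentially_times_top by blast
  qed
  ultimately have "Liminf ?F ?f = liminf ?d" by (rule antisym)
  also have "?d = (\<lambda>n. inverse (ereal (cf_lambda x n)))"
    using lam by (auto simp: inverse_eq_divide less_imp_neq[symmetric] fun_eq_iff)
  also have "liminf \<dots> = inverse (limsup (\<lambda>n. ereal (cf_lambda x n)))"
    using lam by (intro Liminf_inverse_ereal) (auto simp: less_imp_le)
  finally have "lagrange_mu (cf_frac x) = inverse (inverse (limsup (\<lambda>n. ereal (cf_lambda x n))))"
    unfolding lagrange_mu_def by simp
  \<comment> \<open>On \<open>ereal\<close> the double inverse is the identity everywhere except at
    minus infinity, which nonnegativity excludes.\<close>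
  moreover have "0 \<le> limsup (\<lambda>n. ereal (cf_lambda x n))"
    using lam by (intro le_Limsup) (auto simp: less_imp_le)
  then have "inverse (inverse (limsup (\<lambda>n. ereal (cf_lambda x n)))) = limsup (\<lambda>n. ereal (cf_lambda x n))"
    by (cases "limsup (\<lambda>n. ereal (cf_lambda x n))") (auto simp: zero_ereal_def)
  ultimately show ?thesis by simp
qed

text \<open>The mirror formula: a quotient of consecutive denominators is the continued fraction of
  the letters read backwards. This is how the left half of the sequence enters.\<close>

lemma cf_den_ratio:
  assumes "\<forall>i. 0 < A i"
  shows "real (cf_den (\<lambda>k. A (int k)) n) / real (cf_den (\<lambda>k. A (int k)) (Suc n)) =
    cf_tail n (\<lambda>k. A (int n - 1 - int k)) 0"
proof (induction n)
  case (Suc n)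
  let ?K = "cf_den (\<lambda>k. A (int k))"
  have pos: "0 < ?K (Suc n)" using cf_den_pos assms by simp
  have "real (?K (Suc n)) / real (?K (Suc (Suc n))) = 1 / (real (A (int n)) + real (?K n) / real (?K (Suc n)))"
    using pos by (simp add: field_simps)
  then show ?case unfolding Suc.IH by (simp add: algebra_simps del: cf_den.simps)
qed simp

text \<open>The right halves coincide; on the left \<open>cf_lambda\<close> stops after the
  \<open>n\<close> letters down to index 0, where \<open>bi_lambda\<close> continues, and
  contraction bounds the difference.\<close>

lemma cf_lambda_bi_lambda:
  assumes "\<forall>i. 0 < A i"
  shows "\<bar>cf_lambda (\<lambda>k. A (int k)) n - bi_lambda A (int n)\<bar> \<le> 2 * (1 / 2) ^ n"
proof -
  let ?y = "\<lambda>k. A (int n - 1 - int k)"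
  have "1 / cf_frac (\<lambda>k. A (int (n + k))) = real (A (int n)) + cf_frac (\<lambda>k. A (int n + 1 + int k))"
    using cf_frac_rec[of "\<lambda>k. A (int (n + k))"] assms by (simp add: ac_simps)
  then have "cf_lambda (\<lambda>k. A (int k)) n - bi_lambda A (int n) = cf_tail n ?y 0 - cf_frac ?y"
    unfolding cf_lambda_def bi_lambda_eq[OF assms] cf_den_ratio[OF assms] by simp
  moreover have "\<bar>cf_tail n ?y 0 - cf_frac ?y\<bar> \<le> 2 * (1 / 2) ^ n"
    using assms by (subst cf_frac_unfold[of _ n]) (auto intro!: cf_tail_contraction cf_frac_unit)
  ultimately show ?thesis by simp
qed

lemma lagrange_mu_bi_lambda:
  assumes A: "\<forall>i. 0 < A i"
  shows "lagrange_mu (cf_frac (\<lambda>n. A (int n))) = limsup (\<lambda>n. ereal (bi_lambda A (int n)))"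
proof -
  let ?e = "\<lambda>n. cf_lambda (\<lambda>k. A (int k)) n - bi_lambda A (int n)"
  have "?e \<longlonglongrightarrow> 0"
  proof (rule Lim_null_comparison)
    show "(\<lambda>n. 2 * (1 / 2 :: real) ^ n) \<longlonglongrightarrow> 0"
      using tendsto_mult_right_zero[OF LIMSEQ_power_zero[of "1 / 2 :: real"], of 2] by simp
    show "\<forall>\<^sub>F n in sequentially. norm (?e n) \<le> 2 * (1 / 2) ^ n"
      using cf_lambda_bi_lambda[OF A] by simp
  qed
  then have "(\<lambda>n. ereal (?e n)) \<longlonglongrightarrow> ereal 0" by simp
  from ereal_limsup_lim_add[OF this, of "\<lambda>n. ereal (bi_lambda A (int n))"]
  show ?thesis using A by (simp add: lagrange_mu_cf_lambda zero_ereal_def[symmetric])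
qed

section \<open>From real numbers to sequences\<close>

text \<open>For each \<open>q\<close> the translation is absorbed by replacing p with p - q k. One
  inequality for all integer shifts suffices, since the shift can be undone.\<close>

lemma lagrange_mu_add_int: "lagrange_mu (\<alpha> + of_int k) = lagrange_mu \<alpha>"
proof -
  let ?F = "sequentially \<times>\<^sub>F (top :: int filter)"
  define f where "f \<beta> = (\<lambda>(q :: nat, p :: int). ereal \<bar>real q * (real q * \<beta> - real_of_int p)\<bar>)" for \<beta>
  have shift: "f (\<beta> + of_int j) (q, p) = f \<beta> (q, p - int q * j)" for \<beta> j q p
    by (simp add: f_def algebra_simps)
  have le: "Liminf ?F (f \<beta>) \<le> Liminf ?F (f (\<beta> + of_int j))" for \<beta> j
    unfolding le_Liminf_iff
  proof (intro allI impI)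
    fix y assume "y < Liminf ?F (f \<beta>)"
    then have "eventually (\<lambda>z. y < f \<beta> z) ?F" by (rule less_LiminfD)
    then show "eventually (\<lambda>z. y < f (\<beta> + of_int j) z) ?F"
      unfolding eventually_sequentially_times_top shift by blast
  qed
  have "Liminf ?F (f (\<alpha> + of_int k)) = Liminf ?F (f \<alpha>)"
    using le[of \<alpha> k] le[of "\<alpha> + of_int k" "- k"] by (intro antisym) simp_all
  then show ?thesis unfolding lagrange_mu_def f_def by simp
qed

text \<open>The Gauss map: \<open>t n\<close> are the iterates of \<alpha> under r to the fractional
  part of 1/r, the letters are the integer parts of their reciprocals, and contraction makes the
  truncations converge to \<alpha>.\<close>

lemma irrational_cf_frac:
  assumes "\<alpha> \<notin> \<rat>" "0 < \<alpha>" "\<alpha> < 1"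
  obtains x where "\<forall>k. 0 < x k" "\<alpha> = cf_frac x"
proof -
  define t where "t n = ((\<lambda>r. frac (1 / r)) ^^ n) \<alpha>" for n
  have t: "t n \<notin> \<rat> \<and> 0 < t n \<and> t n < 1" for n
  proof (induction n)
    case (Suc n)
    have inv: "1 / t n \<notin> \<rat>"
    proof
      assume "1 / t n \<in> \<rat>"
      from Rats_inverse[OF this] show False using Suc by simp
    qed
    then have "frac (1 / t n) \<notin> \<rat>"
      unfolding frac_def by (metis Rats_add Rats_of_int diff_add_cancel)
    moreover from this have "frac (1 / t n) \<noteq> 0" by (metis Rats_0)
    ultimately show ?case
      using frac_ge_0[of "1 / t n"] frac_lt_1[of "1 / t n"] by (simp add: t_def)
  qed (use assms in \<open>simp add: t_def\<close>)
  define x where "x n = nat \<lfloor>1 / t n\<rfloor>" for n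
  have fl: "1 \<le> \<lfloor>1 / t n\<rfloor>" for n using t[of n] by (simp add: le_floor_iff)
  have pos: "\<forall>k. 0 < x k" using fl by (auto simp: x_def zero_less_nat_eq intro: less_le_trans[OF zero_less_one])
  have step: "t n = 1 / (real (x n) + t (Suc n))" for n
  proof -
    have "real (x n) + t (Suc n) = 1 / t n" proof -
      have "t (Suc n) = frac (1 / t n)" by (simp add: t_def)
      moreover have "real (x n) = of_int \<lfloor>1 / t n\<rfloor>" unfolding x_def
        using order_trans[OF zero_le_one fl] by (rule of_nat_nat)
      ultimately show ?thesis by (simp add: frac_def)
    qed
    then show ?thesis by simp
  qed
  have eq: "t m = cf_tail n (\<lambda>k. x (m + k)) (t (m + n))" for m n
  proof (induction n arbitrary: m)
    case (Suc n)
    show ?case using step[of m] Suc.IH[of "Suc m"] by simp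
  qed simp
  have "(\<lambda>n. cf_tail n x 0) \<longlonglongrightarrow> \<alpha>"
  proof -
    have "(\<lambda>n. cf_tail n x 0 - \<alpha>) \<longlonglongrightarrow> 0"
    proof (rule Lim_null_comparison)
      show "(\<lambda>n. 2 * (1 / 2 :: real) ^ n) \<longlonglongrightarrow> 0"
        using tendsto_mult_right_zero[OF LIMSEQ_power_zero[of "1 / 2 :: real"], of 2] by simp
      have "norm (cf_tail n x 0 - \<alpha>) \<le> 2 * (1 / 2) ^ n" for n
        using eq[of 0 n] cf_tail_contraction[OF pos, of 0 "t n" n] t[of n] by (simp add: t_def)
      then show "\<forall>\<^sub>F n in sequentially. norm (cf_tail n x 0 - \<alpha>) \<le> 2 * (1 / 2) ^ n" by simp
    qed
    then show ?thesis by (rule LIM_zero_cancel)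
  qed
  then have "\<alpha> = cf_frac x" unfolding cf_frac_def by (rule limI[symmetric])
  with pos show ?thesis by (rule that)
qed

lemma lagrange_spectrum_iff:
  "x \<in> lagrange_spectrum \<longleftrightarrow>
    (\<exists>A. (\<forall>i. 0 < A i) \<and> limsup (\<lambda>n. ereal (bi_lambda A (int n))) = ereal x)"
proof
  assume "x \<in> lagrange_spectrum"
  then obtain \<alpha> where \<alpha>: "\<alpha> \<notin> \<rat>" "lagrange_mu \<alpha> = ereal x" unfolding lagrange_spectrum_def by blast
  have fr: "frac \<alpha> \<notin> \<rat>" using \<alpha>(1) unfolding frac_def by (metis Rats_add Rats_of_int diff_add_cancel)
  then have "frac \<alpha> \<noteq> 0" by (metis Rats_0)
  then have "0 < frac \<alpha>" using frac_ge_0[of \<alpha>] by simp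
  then obtain d where d: "\<forall>k. 0 < d k" "frac \<alpha> = cf_frac d"
    using irrational_cf_frac[OF fr] frac_lt_1 by blast
  \<comment> \<open>The expansion occupies the nonnegative indices; the left half is filled with 1,
    one of many positive fillings to which Perron's formula applies.\<close>
  define A where "A i = (if i < 0 then 1 else d (nat i))" for i
  have A: "\<forall>i. 0 < A i" using d by (simp add: A_def)
  have "lagrange_mu \<alpha> = lagrange_mu (frac \<alpha> + of_int \<lfloor>\<alpha>\<rfloor>)" by (simp add: frac_def)
  also have "\<dots> = limsup (\<lambda>n. ereal (bi_lambda A (int n)))"
  proof -
    have "(\<lambda>n. A (int n)) = d" by (simp add: A_def)
    then show ?thesis using lagrange_mu_bi_lambda[OF A] d(2) by (simp add: lagrange_mu_add_int)
  qed
  finally show "\<exists>A. (\<forall>i. 0 < A i) \<and> limsup (\<lambda>n. ereal (bi_lambda A (int n))) = ereal x"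
    using A \<alpha>(2) by auto
next
  assume "\<exists>A. (\<forall>i. 0 < A i) \<and> limsup (\<lambda>n. ereal (bi_lambda A (int n))) = ereal x"
  then obtain A where A: "\<forall>i. 0 < A i" "limsup (\<lambda>n. ereal (bi_lambda A (int n))) = ereal x" by blast
  have "cf_frac (\<lambda>n. A (int n)) \<notin> \<rat>" using A(1) by (intro cf_frac_irrational) simp
  then show "x \<in> lagrange_spectrum"
    using lagrange_mu_bi_lambda[OF A(1)] A(2) unfolding lagrange_spectrum_def by auto
qed

subsection \<open>Windows and greedy extensions\<close>

text \<open>The words are vertices of a finite graph in which every vertex has a successor, so walks
  to the right never get stuck. Walks to the left are treated by reversing all words.\<close>

definition extendable :: "nat \<Rightarrow> nat list set \<Rightarrow> bool" where
  "extendable L W \<longleftrightarrow> finite W \<and> 0 < L \<and>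
     (\<forall>w\<in>W. length w = L \<and> (\<forall>d\<in>set w. 0 < d) \<and> (\<exists>d. tl w @ [d] \<in> W))"

text \<open>For words of length \<open>2 * m + 1\<close>, the letter appended in step \<open>k\<close> has index \<open>m + k\<close>
  (counted from 0) among the letters after the middle of \<open>w\<close>; its parity decides whether a small or a large
  letter increases the continued fraction.\<close>

primrec greedy_state :: "nat list set \<Rightarrow> nat \<Rightarrow> nat list \<Rightarrow> nat \<Rightarrow> nat list" where
  "greedy_state W m w 0 = w"
| "greedy_state W m w (Suc k) = tl (greedy_state W m w k) @
     [(if even (m + k) then Min else Max) {d. tl (greedy_state W m w k) @ [d] \<in> W}]"

definition greedy :: "nat list set \<Rightarrow> nat \<Rightarrow> nat list \<Rightarrow> nat \<Rightarrow> nat" where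
  "greedy W m w k = hd (greedy_state W m w k)"

lemma finite_extensions: "extendable L W \<Longrightarrow> finite {d. u @ [d] \<in> W}"
  by (rule finite_subset[of _ "last ` W"]) (force simp: extendable_def)+

lemma greedy_state_in:
  assumes "extendable L W" "w \<in> W" shows "greedy_state W m w k \<in> W"
proof (induction k)
  case (Suc k)
  let ?D = "{d. tl (greedy_state W m w k) @ [d] \<in> W}"
  have "finite ?D" "?D \<noteq> {}" using finite_extensions[OF assms(1)] Suc assms(1) by (auto simp: extendable_def)
  from Min_in[OF this] Max_in[OF this] show ?case by simp
qed (use assms in simp)

lemma greedy_state_nth:
  assumes "extendable L W" "w \<in> W" "j < L"
  shows "greedy_state W m w k ! j = greedy W m w (k + j)"
  using assms(3)
proof (induction j arbitrary: k)
  case 0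
  have "length (greedy_state W m w k) = L"
    using greedy_state_in[OF assms(1,2)] assms(1) by (auto simp: extendable_def)
  then have "greedy_state W m w k \<noteq> []" using 0 by auto
  then show ?case by (simp add: greedy_def hd_conv_nth)
next
  case (Suc j)
  have len: "length (greedy_state W m w k) = L"
    using greedy_state_in[OF assms(1,2)] assms(1) by (auto simp: extendable_def)
  have "greedy_state W m w k ! Suc j = greedy_state W m w (Suc k) ! j"
    using Suc.prems len less_diff_conv[of j L 1] by (simp add: nth_append nth_tl)
  also have "\<dots> = greedy W m w (Suc k + j)" using Suc by (intro Suc.IH) simp
  finally show ?case by simp
qed

lemma greedy_state_eq_map:
  assumes "extendable L W" "w \<in> W"
  shows "greedy_state W m w k = map (\<lambda>j. greedy W m w (k + j)) [0..<L]"
proof (rule nth_equalityI)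
  show "length (greedy_state W m w k) = length (map (\<lambda>j. greedy W m w (k + j)) [0..<L])"
    using greedy_state_in[OF assms] assms(1) by (auto simp: extendable_def)
  then show "\<And>i. i < length (greedy_state W m w k) \<Longrightarrow> greedy_state W m w k ! i = map (\<lambda>j. greedy W m w (k + j)) [0..<L] ! i"
    using greedy_state_nth[OF assms] by simp
qed

lemma greedy_pos:
  assumes "extendable L W" "w \<in> W" shows "0 < greedy W m w k"
proof -
  have "greedy_state W m w k ! 0 = greedy W m w k" "length (greedy_state W m w k) = L" "0 < L"
    using greedy_state_nth[OF assms, of 0] greedy_state_in[OF assms, of m k] assms(1) by (auto simp: extendable_def)
  then have "greedy W m w k \<in> set (greedy_state W m w k)" by (metis nth_mem)
  then show ?thesis using greedy_state_in[OF assms, of m k] assms(1) by (auto simp: extendable_def)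
qed

text \<open>Pigeonhole: the next state depends only on the present word and the parity of the step,
  and there are finitely many such pairs.\<close>

lemma greedy_eventually_periodic:
  assumes "extendable L W" "w \<in> W" shows "\<exists>n. periodic_seq (\<lambda>k. greedy W m w (n + k))"
proof -
  define f where "f k = (even k, greedy_state W m w k)" for k
  have "range f \<subseteq> UNIV \<times> W" using greedy_state_in[OF assms] by (auto simp: f_def)
  moreover have "finite (UNIV \<times> W :: (bool \<times> nat list) set)" using assms(1) by (simp add: extendable_def)
  ultimately have "finite (range f)" by (rule finite_subset)
  then have "\<not> inj f" using finite_imageD infinite_UNIV_nat by blast
  then obtain i j where "f i = f j" "i \<noteq> j" by (auto simp: inj_def)
  then obtain i t where it: "f (i + t) = f i" "0 < t"
    by (metis add_diff_inverse_nat less_imp_add_positive linorder_neqE_nat)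
  have "f (i + k + t) = f (i + k)" for k
  proof (induction k)
    case (Suc k)
    then have "even (i + k + t) = even (i + k)" "greedy_state W m w (i + k + t) = greedy_state W m w (i + k)"
      by (simp_all add: f_def)
    then show ?case by (simp add: f_def)
  qed (use it in simp)
  then have "periodic_seq (\<lambda>k. greedy W m w (i + k))"
    using it(2) unfolding periodic_seq_def greedy_def f_def by (auto simp: add.assoc)
  then show ?thesis ..
qed

text \<open>Up to the first disagreement both sequences pass through the same state, so the letter
  of \<open>y\<close> was among the choices of the greedy rule, which took the extreme one for the
  right parity. The error term covers agreement on the first \<open>N + L\<close> letters.\<close>

lemma greedy_optimal:
  assumes W: "extendable L W" "w \<in> W" and L: "L = 2 * m + 1"
    and pos: "\<forall>k. 0 < y k" and init: "\<And>k. k < L \<Longrightarrow> y k = w ! k"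
    and win: "\<And>k. k \<le> N \<Longrightarrow> map (\<lambda>j. y (k + j)) [0..<L] \<in> W"
  shows "cf_frac (\<lambda>k. y (m + 1 + k)) \<le> cf_frac (\<lambda>k. greedy W m w (m + 1 + k)) + 2 * (1 / 2) ^ N"
proof -
  let ?g = "greedy W m w"
  have gpos: "\<forall>k. 0 < ?g k" using greedy_pos[OF W] by blast
  show ?thesis
  proof (cases "\<exists>k. k < N + L \<and> y k \<noteq> ?g k")
    case False
    then have "\<bar>cf_frac (\<lambda>k. y (m + 1 + k)) - cf_frac (\<lambda>k. ?g (m + 1 + k))\<bar> \<le> 2 * (1 / 2) ^ N"
      using pos gpos L by (intro cf_frac_agree) auto
    then show ?thesis by linarith
  next
    case True
    define k where "k = (LEAST k. k < N + L \<and> y k \<noteq> ?g k)"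
    have k: "k < N + L" "y k \<noteq> ?g k" using LeastI_ex[OF True] by (simp_all add: k_def)
    have agree: "y i = ?g i" if "i < k" for i
      using not_less_Least[of i "\<lambda>k. k < N + L \<and> y k \<noteq> ?g k"] that k(1) by (auto simp: k_def)
    have "\<not> k < L"
      using k(2) init[of k] greedy_state_nth[OF W, of k m 0] by auto
    \<comment> \<open>The disagreement lies past the initial word, so its letter is the one appended
      in step \<open>j\<close>.\<close>
    then obtain j where j: "k = L + j" by (metis less_imp_add_positive not_less le_iff_add)
    then have jN: "j < N" using k(1) by simp
    define u where "u = tl (greedy_state W m w j)"
    define D where "D = {d. u @ [d] \<in> W}"
    have "map (\<lambda>i. y (Suc j + i)) [0..<L] = u @ [y k]"
    proof -
      have "greedy_state W m w j = map (\<lambda>i. y (j + i)) [0..<L]"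
        unfolding greedy_state_eq_map[OF W] using agree j by auto
      then have "u = map (\<lambda>i. y (Suc j + i)) [0..<2 * m]"
        unfolding u_def L by (simp add: upt_conv_Cons map_Suc_upt[symmetric] comp_def del: map_Suc_upt upt_Suc)
      then show ?thesis using j L by (simp add: ac_simps)
    qed
    then have yD: "y k \<in> D" using win[of "Suc j"] jN by (simp add: D_def)
    have "?g k = greedy_state W m w (Suc j) ! (L - 1)"
      using greedy_state_nth[OF W, of "L - 1" m "Suc j"] j L by (simp add: add.commute del: greedy_state.simps)
    also have "length u = L - 1"
      using greedy_state_in[OF W, of m j] W(1) by (auto simp: u_def extendable_def)
    then have "greedy_state W m w (Suc j) ! (L - 1) = (if even (m + j) then Min else Max) D"
      by (simp add: u_def[symmetric] D_def nth_append)
    finally have g: "?g k = (if even (m + j) then Min else Max) D" .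
    have "finite D" unfolding D_def by (rule finite_extensions[OF W(1)])
    then have "if even (m + j) then ?g k < y k else y k < ?g k"
      using yD k(2) g Min_le[of D "y k"] Max_ge[of D "y k"] by (auto simp: le_less)
    \<comment> \<open>Letter \<open>k\<close> has position \<open>m + j\<close> in the fraction
      starting at \<open>m + 1\<close>, which is the parity tested by the greedy rule.\<close>
    moreover have "m + 1 + (m + j) = k" using j L by simp
    ultimately have "cf_frac (\<lambda>k. y (m + 1 + k)) \<le> cf_frac (\<lambda>k. ?g (m + 1 + k))"
      using pos gpos by (intro cf_frac_alternating[of _ _ "m + j"]) (auto simp: agree)
    then show ?thesis by (simp add: add_increasing2)
  qed
qed

section \<open>Windows of bi-infinite sequences\<close>

definition window :: "nat \<Rightarrow> (int \<Rightarrow> 'a) \<Rightarrow> int \<Rightarrow> 'a list" where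
  "window L X i = map (\<lambda>j. X (i + int j)) [0..<L]"

lemma length_window [simp]: "length (window L X i) = L"
  by (simp add: window_def)

lemma window_nth: "j < L \<Longrightarrow> window L X i ! j = X (i + int j)"
  by (simp add: window_def)

lemma window_eq_iff: "window L X i = window L Y j \<longleftrightarrow> (\<forall>k. 0 \<le> k \<and> k < int L \<longrightarrow> X (i + k) = Y (j + k))"
proof -
  have "window L X i = window L Y j \<longleftrightarrow> (\<forall>k<L. X (i + int k) = Y (j + int k))"
    by (simp add: list_eq_iff_nth_eq window_nth)
  also have "\<dots> \<longleftrightarrow> (\<forall>k. 0 \<le> k \<and> k < int L \<longrightarrow> X (i + k) = Y (j + k))"
    by (metis of_nat_0_le_iff of_nat_less_iff zero_le_imp_eq_int)
  finally show ?thesis .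
qed

lemma window_Suc: "0 < L \<Longrightarrow> window L X (i + 1) = tl (window L X i) @ [X (i + int L)]"
proof (rule nth_equalityI)
  fix j assume "0 < L" "j < length (window L X (i + 1))"
  then show "window L X (i + 1) ! j = (tl (window L X i) @ [X (i + int L)]) ! j"
    by (cases "j = L - 1") (auto simp: window_nth nth_append nth_tl algebra_simps of_nat_diff)
qed simp

lemma rev_window: "rev (window L X i) = map (\<lambda>j. X (i + int L - 1 - int j)) [0..<L]"
  by (rule nth_equalityI) (auto simp: window_nth rev_nth algebra_simps of_nat_diff)

definition recurrent_windows :: "nat \<Rightarrow> (int \<Rightarrow> 'a) \<Rightarrow> 'a list set" where
  "recurrent_windows L A = {w. \<forall>N. \<exists>n\<ge>N. window L A (int n) = w}"

text \<open>Bounded letters leave finitely many words of length \<open>L\<close>, and each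
  nonrecurrent one disappears from some point on.\<close>

lemma eventually_recurrent:
  fixes A :: "int \<Rightarrow> nat"
  assumes "\<forall>n\<ge>N. A (int n) \<le> B"
  shows "finite (recurrent_windows L A)" "\<exists>N. \<forall>n\<ge>N. window L A (int n) \<in> recurrent_windows L A"
proof -
  define S where "S = {w. set w \<subseteq> {..B} \<and> length w = L}"
  have S: "finite S" unfolding S_def by (rule finite_lists_length_eq) simp
  have inS: "window L A (int n) \<in> S" if "N \<le> n" for n
    using assms that unfolding S_def window_def by (auto simp flip: of_nat_add)
  have "recurrent_windows L A \<subseteq> S"
    using inS unfolding recurrent_windows_def by blast
  then show "finite (recurrent_windows L A)" using S by (rule finite_subset)
  have "\<forall>\<^sub>F n in sequentially. \<forall>w\<in>S - recurrent_windows L A. window L A (int n) \<noteq> w"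
    using S by (intro eventually_ball_finite) (auto simp: recurrent_windows_def eventually_sequentially)
  then obtain N' where "\<forall>n\<ge>N'. \<forall>w\<in>S - recurrent_windows L A. window L A (int n) \<noteq> w"
    unfolding eventually_sequentially by blast
  then have "\<forall>n\<ge>max N N'. window L A (int n) \<in> recurrent_windows L A" using inS by fastforce
  then show "\<exists>N. \<forall>n\<ge>N. window L A (int n) \<in> recurrent_windows L A" ..
qed

text \<open>A recurrent word occurs so late that the windows one place to its right and to its left
  are recurrent as well; they supply the two extensions.\<close>

lemma recurrent_extendable:
  assumes A: "\<forall>i. 0 < A i" and L: "0 < L" and fin: "finite (recurrent_windows L A)"
    and rec: "\<forall>n\<ge>N. window L A (int n) \<in> recurrent_windows L A"
  shows "extendable L (recurrent_windows L A)" "extendable L (rev ` recurrent_windows L A)"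
proof -
  let ?R = "recurrent_windows L A"
  have ex: "\<exists>n\<ge>M. window L A (int n) = w" if "w \<in> ?R" for w M
    using that unfolding recurrent_windows_def by blast
  have len: "length w = L \<and> (\<forall>d\<in>set w. 0 < d)" if w: "w \<in> ?R" for w
  proof -
    obtain n where "w = window L A (int n)" using ex[OF w, of 0] by blast
    then show ?thesis using A by (auto simp: window_def)
  qed
  have right: "\<exists>d. tl w @ [d] \<in> ?R" if w: "w \<in> ?R" for w
  proof -
    obtain n where n: "N \<le> n" "window L A (int n) = w" using ex[OF w] by blast
    then have "tl w @ [A (int n + int L)] \<in> ?R"
      using rec[rule_format, of "Suc n"] window_Suc[OF L, of A "int n"] by (simp add: add.commute)
    then show ?thesis ..
  qed
  have left: "\<exists>d. tl (rev w) @ [d] \<in> rev ` ?R" if w: "w \<in> ?R" for w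
  proof -
    obtain n where n: "Suc N \<le> n" "window L A (int n) = w" using ex[OF w] by blast
    define v where "v = window L A (int (n - 1))"
    have v: "v \<in> ?R" unfolding v_def using n(1) by (intro rec[rule_format]) simp
    have "w = tl v @ [A (int (n - 1) + int L)]"
      using window_Suc[OF L, of A "int (n - 1)"] n by (simp add: v_def of_nat_diff)
    moreover have "v \<noteq> []" using L by (auto simp: v_def window_def)
    then have "rev v = rev (tl v) @ [hd v]" by (cases v) auto
    ultimately have "tl (rev w) @ [hd v] = rev v" by simp
    then show ?thesis using v by (metis imageI)
  qed
  show "extendable L ?R" using fin L len right by (auto simp: extendable_def)
  show "extendable L (rev ` ?R)" using fin L len left by (auto simp: extendable_def)
qed

text \<open>Closing a long central block of \<open>X\<close> by a stretch of \<open>A\<close> that joins its two end windows.\<close>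

lemma periodic_closing:
  assumes L: "0 < L" and rec: "\<forall>n\<ge>M. window L A (int n) \<in> recurrent_windows L A"
    and X: "\<forall>i. window L X i \<in> recurrent_windows L A"
  shows "\<exists>P T. 0 < T \<and> (\<forall>k. P (k + int T) = P k) \<and>
    (\<forall>i. window L P i \<in> recurrent_windows L A) \<and> (\<forall>k. \<bar>k\<bar> \<le> int N \<longrightarrow> P k = X k)"
proof -
  define R where "R = int N + int L"
  have ex: "\<exists>n\<ge>K. window L A (int n) = window L X i" for K i
    using X unfolding recurrent_windows_def by blast
  obtain n0 where n0: "M \<le> n0" "window L A (int n0) = window L X R" using ex by blast
  obtain n1 where n1: "n0 + L \<le> n1" "window L A (int n1) = window L X (- R)" using ex by blast
  \<comment> \<open>One period consists of \<open>X\<close> from \<open>- R\<close> to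
    \<open>R - 1\<close> followed by \<open>A\<close> from \<open>n0\<close> to
    \<open>n1 - 1\<close>, moved so that it starts at 0.\<close>
  define S where "S = 2 * R"
  define T where "T = S + (int n1 - int n0)"
  define Q where "Q k = (if k < S then X (k - R) else A (int n0 + k - S))" for k
  define Y where "Y k = Q (k mod T)" for k
  have bounds: "0 < R" "int L \<le> R" "int L \<le> S" "int L \<le> T - S" "S < T" "0 < S" "0 < T"
    using L n1(1) by (auto simp: R_def S_def T_def)
  have join0: "A (int n0 + k) = X (R + k)" if "0 \<le> k" "k < int L" for k
    using n0(2) that unfolding window_eq_iff by blast
  have join1: "A (int n1 + k) = X (- R + k)" if "0 \<le> k" "k < int L" for k
    using n1(2) that unfolding window_eq_iff by blast
  \<comment> \<open>The matching end windows let each of the two descriptions run \<open>L\<close>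
    letters past its piece, so every window starting in a piece lies within its description.\<close>
  have Y0: "Y k = X (k - R)" if "0 \<le> k" "k < S + int L" for k
  proof (cases "k < S")
    case True
    then show ?thesis using that bounds by (simp add: Y_def Q_def)
  next
    case False
    then have "Y k = A (int n0 + (k - S))" using that bounds by (simp add: Y_def Q_def algebra_simps)
    then show ?thesis using join0[of "k - S"] False that by (simp add: S_def algebra_simps)
  qed
  have Y1: "Y k = A (int n0 + k - S)" if "S \<le> k" "k < T + int L" for k
  proof (cases "k < T")
    case True
    then show ?thesis using that bounds by (simp add: Y_def Q_def)
  next
    case False
    have "k mod T = (k - T) mod T" by simp
    also have "\<dots> = k - T" using False that bounds by (intro mod_pos_pos_trivial) auto
    finally have "Y k = X (k - T - R)" using that bounds by (simp add: Y_def Q_def)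
    then show ?thesis using join1[of "k - T"] False that by (simp add: T_def algebra_simps)
  qed
  have per: "Y (k + T) = Y k" for k by (simp add: Y_def)
  have Ymod: "Y (i + k) = Y (i mod T + k)" for i k by (simp add: Y_def mod_add_left_eq)
  have Yrec: "window L Y i \<in> recurrent_windows L A" for i
  proof -
    define i' where "i' = i mod T"
    have i': "0 \<le> i'" "i' < T" using bounds by (simp_all add: i'_def)
    have eq: "window L Y i = window L Y i'" unfolding window_eq_iff using Ymod by (simp add: i'_def)
    show ?thesis
    proof (cases "i' < S")
      case True
      have "window L Y i' = window L X (i' - R)"
        unfolding window_eq_iff using True i' Y0 by (simp add: algebra_simps)
      then show ?thesis using X eq by simp
    next
      case False
      have "window L Y i' = window L A (int n0 + i' - S)"
        unfolding window_eq_iff using False i' Y1 by (simp add: algebra_simps)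
      also have "int n0 + i' - S = int (n0 + nat (i' - S))" using False by simp
      finally have "window L Y i = window L A (int (n0 + nat (i' - S)))" using eq by simp
      moreover have "M \<le> n0 + nat (i' - S)" using n0(1) by simp
      ultimately show ?thesis using rec by metis
    qed
  qed
  show ?thesis
  proof (intro exI conjI allI impI)
    show "0 < nat T" using bounds by simp
    show "Y (k + int (nat T) + R) = Y (k + R)" for k
      using per[of "k + R"] bounds by (simp add: ac_simps)
    show "window L (\<lambda>k. Y (k + R)) i \<in> recurrent_windows L A" for i
      using Yrec[of "i + R"] by (simp add: window_def ac_simps)
    show "Y (k + R) = X k" if "\<bar>k\<bar> \<le> int N" for k
      using Y0[of "k + R"] that L by (simp add: R_def S_def)
  qed
qed

text \<open>Only finitely many values occur, and the largest recurs at arbitrarily large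
  indices.\<close>

lemma limsup_periodic:
  fixes f :: "int \<Rightarrow> real"
  assumes T: "0 < T" and per: "\<And>k. f (k + int T) = f k"
  shows "\<exists>i. (\<forall>j. f j \<le> f i) \<and> limsup (\<lambda>n. ereal (f (int n))) = ereal (f i)"
proof -
  have per': "f (k + int n * int T) = f k" for k n
  proof (induction n)
    case (Suc n)
    then show ?case using per[of "k + int n * int T"] by (simp add: algebra_simps)
  qed simp
  have fmod: "f j = f (j mod int T)" for j
  proof (cases "0 \<le> j div int T")
    case True
    then show ?thesis using per'[of "j mod int T" "nat (j div int T)"] by simp
  next
    case False
    then show ?thesis using per'[of j "nat (- (j div int T))"]
      by (simp add: minus_div_mult_eq_mod[symmetric])
  qed
  have "finite (f ` {0..<int T})" "f ` {0..<int T} \<noteq> {}" using T by auto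
  note fin = Max_in[OF this] Max_ge[OF this(1)]
  then obtain i where i: "f i = Max (f ` {0..<int T})" by auto
  have max: "f j \<le> f i" for j
    unfolding i using T by (subst fmod) (intro fin(2) imageI, simp)
  have "limsup (\<lambda>n. ereal (f (int n))) = ereal (f i)"
  proof (rule antisym)
    show "limsup (\<lambda>n. ereal (f (int n))) \<le> ereal (f i)" using max by (intro Limsup_bounded) simp
    show "ereal (f i) \<le> limsup (\<lambda>n. ereal (f (int n)))"
    proof (rule ccontr)
      assume "\<not> ereal (f i) \<le> limsup (\<lambda>n. ereal (f (int n)))"
      then have "limsup (\<lambda>n. ereal (f (int n))) < ereal (f i)" by simp
      from Limsup_lessD[OF this] obtain N where N: "\<And>n. N \<le> n \<Longrightarrow> f (int n) < f i"
        unfolding eventually_sequentially by auto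
      define n where "n = nat (i mod int T) + N * T"
      have "N \<le> N * T" using T by simp
      then have "N \<le> n" unfolding n_def by linarith
      moreover have "f (int n) = f i"
        using per'[of "i mod int T" N] fmod[of i] T by (simp add: n_def)
      ultimately show False using N[of n] by simp
    qed
  qed
  with max show ?thesis by blast
qed

subsection \<open>Two-sided greedy sequences and the gap\<close>

text \<open>The word \<open>w\<close> occupies the indices from \<open>- m\<close> to
  \<open>m\<close>, with its middle at 0; it is continued greedily to the right, and to the left by
  the greedy rule for reversed words.\<close>

definition greedy_bi :: "nat list set \<Rightarrow> nat \<Rightarrow> nat list \<Rightarrow> int \<Rightarrow> nat" where
  "greedy_bi W m w k = (if k < - int m then greedy (rev ` W) m (rev w) (nat (int m - k))
     else greedy W m w (nat (k + int m)))"

lemma greedy_bi_right: "- int m \<le> k \<Longrightarrow> greedy_bi W m w k = greedy W m w (nat (k + int m))"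
  by (simp add: greedy_bi_def)

context
  fixes W :: "nat list set" and m L :: nat and w :: "nat list"
  assumes W: "extendable L W" and W': "extendable L (rev ` W)" and w: "w \<in> W"
    and L: "L = 2 * m + 1"
begin

lemma rev_word_in: "rev w \<in> rev ` W" using w by simp

lemma length_word: "length w = 2 * m + 1"
  using W w L by (auto simp: extendable_def)

text \<open>Between \<open>- m\<close> and \<open>m\<close> both formulas read off \<open>w\<close>,
  so the leftward one is valid up to \<open>m\<close>.\<close>

lemma greedy_bi_left:
  assumes "k \<le> int m"
  shows "greedy_bi W m w k = greedy (rev ` W) m (rev w) (nat (int m - k))"
proof (cases "k < - int m")
  case False
  have "greedy W m w (nat (k + int m)) = w ! nat (k + int m)"
    using greedy_state_nth[OF W w, of "nat (k + int m)" m 0] assms L False by simp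
  also have "\<dots> = rev w ! nat (int m - k)"
  proof -
    have "nat (int m - k) < length w" "length w - Suc (nat (int m - k)) = nat (k + int m)"
      using length_word assms False by auto
    then show ?thesis by (simp add: rev_nth)
  qed
  also have "\<dots> = greedy (rev ` W) m (rev w) (nat (int m - k))"
    using greedy_state_nth[OF W' rev_word_in, of "nat (int m - k)" m 0] assms L False by simp
  finally show ?thesis using False by (simp add: greedy_bi_def)
qed (simp add: greedy_bi_def)

lemma greedy_bi_pos: "0 < greedy_bi W m w k"
  using greedy_pos[OF W w] greedy_pos[OF W' rev_word_in] by (simp add: greedy_bi_def)

text \<open>The overlap has the length of a window, so a window never straddles: it lies in the
  right half if it starts at \<open>- m\<close> or later, and in the left half otherwise.\<close>

lemma greedy_bi_window: "window L (greedy_bi W m w) i \<in> W"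
proof (cases "- int m \<le> i")
  case True
  have "window L (greedy_bi W m w) i = greedy_state W m w (nat (i + int m))"
    unfolding greedy_state_eq_map[OF W w] window_def
    using True by (intro map_cong) (auto simp: greedy_bi_right intro!: arg_cong[of _ _ "greedy W m w"])
  then show ?thesis using greedy_state_in[OF W w] by simp
next
  case False
  have "rev (window L (greedy_bi W m w) i) = greedy_state (rev ` W) m (rev w) (nat (- i - int m))"
    unfolding greedy_state_eq_map[OF W' rev_word_in] rev_window
    using False L by (intro map_cong) (auto simp: greedy_bi_left intro!: arg_cong[of _ _ "greedy (rev ` W) m (rev w)"])
  then have "rev (window L (greedy_bi W m w) i) \<in> rev ` W" using greedy_state_in[OF W' rev_word_in] by simp
  then show ?thesis by (simp add: image_iff)
qed

lemma greedy_bi_eventually_periodic: "eventually_periodic (greedy_bi W m w)"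
proof -
  obtain r where r: "periodic_seq (\<lambda>k. greedy W m w (r + k))"
    using greedy_eventually_periodic[OF W w] by blast
  obtain l where l: "periodic_seq (\<lambda>k. greedy (rev ` W) m (rev w) (l + k))"
    using greedy_eventually_periodic[OF W' rev_word_in] by blast
  have later: "periodic_seq (\<lambda>k. s (n' + k))" if per: "periodic_seq (\<lambda>k. s (n + k))" and le: "n \<le> n'"
    for s :: "nat \<Rightarrow> nat" and n n'
  proof -
    obtain t where t: "0 < t" "\<forall>k. s (n + (k + t)) = s (n + k)"
      using per unfolding periodic_seq_def by blast
    have "s (n' + (k + t)) = s (n' + k)" for k
      using t(2)[rule_format, of "n' - n + k"] le by (simp add: add.assoc[symmetric])
    with t(1) show ?thesis unfolding periodic_seq_def by blast
  qed
  \<comment> \<open>\<open>eventually_periodic\<close> asks for one index serving both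
    directions.\<close>
  define n where "n = max r l"
  have "(\<lambda>k. greedy_bi W m w (int n + int k)) = (\<lambda>k. greedy W m w (n + m + k))"
    by (auto simp: greedy_bi_right fun_eq_iff intro!: arg_cong[of _ _ "greedy W m w"])
  moreover have "(\<lambda>k. greedy_bi W m w (- int n - int k)) = (\<lambda>k. greedy (rev ` W) m (rev w) (n + m + k))"
    by (auto simp: greedy_bi_left fun_eq_iff intro!: arg_cong[of _ _ "greedy (rev ` W) m (rev w)"])
  moreover have "periodic_seq (\<lambda>k. greedy W m w (n + m + k))" by (rule later[OF r]) (simp add: n_def)
  moreover have "periodic_seq (\<lambda>k. greedy (rev ` W) m (rev w) (n + m + k))" by (rule later[OF l]) (simp add: n_def)
  ultimately show ?thesis unfolding eventually_periodic_def by (intro exI[of _ "int n"]) simp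
qed

text \<open>One-sided optimality is applied to the right and, with reversed words, to the left. The
  leftward comparison looks back \<open>N\<close> steps, which is why windows are controlled from
  \<open>n - int m - int N\<close> on.\<close>

lemma greedy_bi_optimal:
  assumes A: "\<forall>i. 0 < A i" and mid: "window L A (n - int m) = w"
    and win: "\<And>i. n - int m - int N \<le> i \<Longrightarrow> window L A i \<in> W"
  shows "bi_lambda A n \<le> bi_lambda (greedy_bi W m w) 0 + 4 * (1 / 2) ^ N"
proof -
  have wk: "w ! k = A (n - int m + int k)" if "k < L" for k
    using window_nth[OF that, of A "n - int m"] mid by simp
  have right: "cf_frac (\<lambda>k. A (n + 1 + int k)) \<le> cf_frac (\<lambda>k. greedy_bi W m w (0 + 1 + int k)) + 2 * (1 / 2) ^ N"
  proof -
    let ?y = "\<lambda>k. A (n - int m + int k)"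
    have "cf_frac (\<lambda>k. ?y (m + 1 + k)) \<le> cf_frac (\<lambda>k. greedy W m w (m + 1 + k)) + 2 * (1 / 2) ^ N"
    proof (rule greedy_optimal[OF W w L])
      show "map (\<lambda>j. ?y (k + j)) [0..<L] \<in> W" for k
        using win[of "n - int m + int k"] by (simp add: window_def add.assoc)
    qed (use A wk in auto)
    moreover have "(\<lambda>k. ?y (m + 1 + k)) = (\<lambda>k. A (n + 1 + int k))" by (simp add: algebra_simps)
    moreover have "(\<lambda>k. greedy W m w (m + 1 + k)) = (\<lambda>k. greedy_bi W m w (0 + 1 + int k))"
      by (auto simp: greedy_bi_right fun_eq_iff intro!: arg_cong[of _ _ "greedy W m w"])
    ultimately show ?thesis by simp
  qed
  have left: "cf_frac (\<lambda>k. A (n - 1 - int k)) \<le> cf_frac (\<lambda>k. greedy_bi W m w (0 - 1 - int k)) + 2 * (1 / 2) ^ N"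
  proof -
    let ?y = "\<lambda>k. A (n + int m - int k)"
    have "cf_frac (\<lambda>k. ?y (m + 1 + k)) \<le> cf_frac (\<lambda>k. greedy (rev ` W) m (rev w) (m + 1 + k)) + 2 * (1 / 2) ^ N"
    proof (rule greedy_optimal[OF W' rev_word_in L])
      show "?y k = rev w ! k" if "k < L" for k
        using that L length_word wk[of "2 * m - k"] by (simp add: rev_nth of_nat_diff algebra_simps)
      show "map (\<lambda>j. ?y (k + j)) [0..<L] \<in> rev ` W" if "k \<le> N" for k
      proof -
        have "map (\<lambda>j. ?y (k + j)) [0..<L] = rev (window L A (n - int m - int k))"
          unfolding rev_window L by (simp add: algebra_simps)
        then show ?thesis using win[of "n - int m - int k"] that by simp
      qed
    qed (use A in auto)
    moreover have "(\<lambda>k. ?y (m + 1 + k)) = (\<lambda>k. A (n - 1 - int k))" by (simp add: algebra_simps)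
    moreover have "(\<lambda>k. greedy (rev ` W) m (rev w) (m + 1 + k)) = (\<lambda>k. greedy_bi W m w (0 - 1 - int k))"
      by (auto simp: greedy_bi_left fun_eq_iff intro!: arg_cong[of _ _ "greedy (rev ` W) m (rev w)"])
    ultimately show ?thesis by simp
  qed
  have "greedy_bi W m w 0 = w ! m"
    using greedy_state_nth[OF W w, of m m 0] L by (simp add: greedy_bi_right)
  then have "A n = greedy_bi W m w 0" using wk[of m] L by simp
  moreover have "\<forall>i. 0 < greedy_bi W m w i" using greedy_bi_pos by blast
  ultimately show ?thesis using right left unfolding bi_lambda_eq[OF A] by (subst bi_lambda_eq) auto
qed

end

section \<open>Quadratic irrationalities\<close>

lemma quadratic_irrational_add_nat:
  assumes "quadratic_irrational u" shows "quadratic_irrational (real n + u)"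
proof -
  obtain a b c :: int where u: "u \<notin> \<rat>" "a \<noteq> 0" "of_int a * u\<^sup>2 + of_int b * u + of_int c = 0"
    using assms unfolding quadratic_irrational_def by blast
  have "real n + u \<notin> \<rat>" using u(1) Rats_diff[of "real n + u" "real n"] by auto
  moreover
  have "of_int a * (real n + u)\<^sup>2 + of_int (b - 2 * a * int n) * (real n + u)
      + of_int (a * (int n)\<^sup>2 - b * int n + c) = of_int a * u\<^sup>2 + of_int b * u + of_int c"
    by (simp add: power2_eq_square algebra_simps)
  then have "of_int a * (real n + u)\<^sup>2 + of_int (b - 2 * a * int n) * (real n + u)
      + of_int (a * (int n)\<^sup>2 - b * int n + c) = 0" using u(3) by simp
  ultimately show ?thesis using u(2) unfolding quadratic_irrational_def by blast
qed

text \<open>Reversing the coefficients of the equation of \<open>u\<close> gives one for its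
  reciprocal; irrationality keeps the new leading coefficient \<open>c\<close> nonzero.\<close>

lemma quadratic_irrational_inverse:
  assumes "quadratic_irrational u" shows "quadratic_irrational (1 / u)"
proof -
  obtain a b c :: int where u: "u \<notin> \<rat>" "a \<noteq> 0" "of_int a * u\<^sup>2 + of_int b * u + of_int c = 0"
    using assms unfolding quadratic_irrational_def by blast
  have u0: "u \<noteq> 0" using u(1) by auto
  have "1 / u \<notin> \<rat>" using u(1) Rats_inverse[of "1 / u"] by auto
  moreover have "c \<noteq> 0"
  proof
    assume "c = 0"
    then have "u * (of_int a * u + of_int b) = 0" using u(3) by (simp add: power2_eq_square algebra_simps)
    then have "of_int a * u + of_int b = 0" using u0 by (simp only: mult_eq_0_iff) simp
    then have "u = - of_int b / of_int a" using u(2) by (simp add: field_simps)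
    then show False using u(1) by simp
  qed
  moreover have "of_int c * (1 / u)\<^sup>2 + of_int b * (1 / u) + of_int a = 0"
  proof -
    have "of_int c * (1 / u)\<^sup>2 + of_int b * (1 / u) + of_int a = (of_int a * u\<^sup>2 + of_int b * u + of_int c) / u\<^sup>2"
      using u0 by (simp add: field_simps power2_eq_square)
    then show ?thesis using u(3) by simp
  qed
  ultimately show ?thesis unfolding quadratic_irrational_def by blast
qed

lemma quadratic_irrational_cf_tail:
  "quadratic_irrational u \<Longrightarrow> quadratic_irrational (cf_tail n x u)"
  by (induction n arbitrary: x) (simp_all add: quadratic_irrational_inverse quadratic_irrational_add_nat)

text \<open>The periodic tail is a fixed point of the Moebius map of one period, hence a root of an
  integral quadratic; the letters in front preserve this property.\<close>

lemma quadratic_irrational_cf_frac: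
  assumes x: "\<forall>k. 0 < x k" and per: "periodic_seq (\<lambda>k. x (n + k))"
  shows "quadratic_irrational (cf_frac x)"
proof -
  define y where "y k = x (n + k)" for k
  have y: "\<forall>k. 0 < y k" using x by (simp add: y_def)
  obtain t where t: "0 < t" "\<And>k. y (k + t) = y k" using per unfolding periodic_seq_def y_def by blast
  define u where "u = cf_frac y"
  \<comment> \<open>The leading coefficient will be \<open>cf_den y t\<close>, positive because
    \<open>t\<close> is a successor.\<close>
  obtain s where s: "t = Suc s" using t(1) by (cases t) auto
  define h0 h1 k0 k1 where kh: "h0 = int (cf_num y t)" "h1 = int (cf_num y (Suc t))"
    "k0 = int (cf_den y t)" "k1 = int (cf_den y (Suc t))"
  have k: "0 < k0" "0 \<le> k1" using cf_den_pos[OF y, of s] by (simp_all add: kh s del: cf_den.simps)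
  have u0: "0 \<le> u" using cf_frac_unit[OF y] by (simp add: u_def)
  have per_y: "(\<lambda>k. y (t + k)) = y" using t(2) by (simp add: add.commute)
  have "u = cf_tail t y u" using cf_frac_unfold[OF y, of t] unfolding per_y u_def .
  also have "\<dots> = (of_int h1 + u * of_int h0) / (of_int k1 + u * of_int k0)"
    using cf_tail_eq[OF y u0, of t] by (simp add: kh)
  finally have eq: "u = (of_int h1 + u * of_int h0) / (of_int k1 + u * of_int k0)" .
  have upos: "0 < u" using cf_frac_bounds[OF y] by (simp add: u_def)
  have "0 < of_int k1 + u * of_int k0" using k upos by (simp add: add_nonneg_pos)
  then have "u * (of_int k1 + u * of_int k0) = of_int h1 + u * of_int h0"
    using eq by (simp add: eq_divide_eq)
  then have "of_int k0 * u\<^sup>2 + of_int (k1 - h0) * u + of_int (- h1) = 0"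
    by (simp add: power2_eq_square algebra_simps)
  moreover have "u \<notin> \<rat>" unfolding u_def by (rule cf_frac_irrational[OF y])
  moreover have "k0 \<noteq> 0" using k by simp
  ultimately have "quadratic_irrational u" unfolding quadratic_irrational_def by blast
  then show ?thesis
    using quadratic_irrational_cf_tail[of u n x] cf_frac_unfold[OF x, of n] unfolding u_def y_def by simp
qed

lemma bi_lambda_quadratic:
  assumes A: "\<forall>i. 0 < A i" and per: "eventually_periodic A"
  shows "\<exists>x y. quadratic_irrational x \<and> quadratic_irrational y \<and> bi_lambda A 0 = x + y"
proof -
  obtain n where n: "periodic_seq (\<lambda>k. A (n + int k))" "periodic_seq (\<lambda>k. A (- n - int k))"
    using per unfolding eventually_periodic_def by blast
  \<comment> \<open>The index \<open>n\<close> may be negative. Moving \<open>d\<close> places on in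
    both directions makes periodicity start at \<open>1 + nat n\<close> and
    \<open>- 1 - nat n\<close>, inside the two fractions of \<open>bi_lambda A 0\<close>.\<close>
  define d where "d = nat (1 + int (nat n) - n)"
  have d: "int d = 1 + int (nat n) - n" by (simp add: d_def)
  have shift: "periodic_seq (\<lambda>k. s (d + k))" if per_s: "periodic_seq s" for s :: "nat \<Rightarrow> nat"
  proof -
    obtain t where "0 < t" "\<forall>k. s (k + t) = s k" using per_s unfolding periodic_seq_def by blast
    then show ?thesis unfolding periodic_seq_def by (intro exI[of _ t]) (simp add: add.assoc[symmetric])
  qed
  have "n + int (d + k) = 1 + int (nat n + k)" for k using d by linarith
  then have "periodic_seq (\<lambda>k. A (1 + int (nat n + k)))" using shift[OF n(1)] by (simp only:)
  then have r: "quadratic_irrational (cf_frac (\<lambda>k. A (1 + int k)))"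
    using A by (intro quadratic_irrational_cf_frac[of _ "nat n"]) auto
  have "- n - int (d + k) = - 1 - int (nat n + k)" for k using d by linarith
  then have "periodic_seq (\<lambda>k. A (- 1 - int (nat n + k)))" using shift[OF n(2)] by (simp only:)
  then have l: "quadratic_irrational (cf_frac (\<lambda>k. A (- 1 - int k)))"
    using A by (intro quadratic_irrational_cf_frac[of _ "nat n"]) auto
  have "bi_lambda A 0 = (real (A 0) + cf_frac (\<lambda>k. A (- 1 - int k))) + cf_frac (\<lambda>k. A (1 + int k))"
    using bi_lambda_eq[OF A, of 0] by simp
  then show ?thesis using r quadratic_irrational_add_nat[OF l] by blast
qed

lemma bi_lambda_shift: "bi_lambda (\<lambda>k. A (j + k)) i = bi_lambda A (j + i)"
  unfolding bi_lambda_def by (simp add: algebra_simps cong: if_cong)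

lemma bi_M_periodic_in_spectrum:
  assumes P: "\<forall>i. 0 < P i" and T: "0 < T" and per: "\<And>k. P (k + int T) = P k"
  shows "\<exists>i. (\<forall>j. bi_lambda P j \<le> bi_lambda P i) \<and> bi_lambda P i \<in> lagrange_spectrum"
proof -
  have "bi_lambda P (k + int T) = bi_lambda P k" for k
    using bi_lambda_shift[of P "int T" k] per by (simp add: add.commute)
  from limsup_periodic[of T "bi_lambda P", OF T this] obtain i where
    "\<forall>j. bi_lambda P j \<le> bi_lambda P i" "limsup (\<lambda>n. ereal (bi_lambda P (int n))) = ereal (bi_lambda P i)"
    by blast
  then show ?thesis using P unfolding lagrange_spectrum_iff by blast
qed

section \<open>The gap argument\<close>

theorem theorem3:
  fixes a b :: real
  assumes "maximal_gap lagrange_spectrum a b"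
  shows "(\<exists>A :: int \<Rightarrow> nat. (\<forall>i. A i > 0) \<and> eventually_periodic A \<and>
            a = bi_lambda A 0 \<and> ereal a = bi_M A) \<and>
         (\<exists>x y. quadratic_irrational x \<and> quadratic_irrational y \<and> a = x + y)"
proof -
  have ab: "a < b" and "a \<in> lagrange_spectrum" and gap: "{a<..<b} \<inter> lagrange_spectrum = {}"
    using assms unfolding maximal_gap_def by auto
  then obtain A where A: "\<forall>i. 0 < A i" and lim: "limsup (\<lambda>n. ereal (bi_lambda A (int n))) = ereal a"
    unfolding lagrange_spectrum_iff by blast
  \<comment> \<open>The midpoint leaves room twice: late values of \<open>A\<close> stay below
    \<open>c\<close>, and \<open>b - c\<close> remains for the error of a window.\<close>
  define c where "c = (a + b) / 2"
  have c: "a < c" "c < b" using ab by (simp_all add: c_def)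
  have "limsup (\<lambda>n. ereal (bi_lambda A (int n))) < ereal c" using lim c by simp
  from Limsup_lessD[OF this] obtain K where K: "\<And>n. K \<le> n \<Longrightarrow> bi_lambda A (int n) < c"
    unfolding eventually_sequentially by auto
  have "\<forall>n\<ge>K. A (int n) \<le> nat \<lceil>c\<rceil>"
  proof (intro allI impI)
    fix n assume "K \<le> n"
    have "real (A (int n)) \<le> bi_lambda A (int n)"
      unfolding bi_lambda_eq[OF A] using A cf_frac_unit(1) by (simp add: add_nonneg_nonneg)
    then have "real (A (int n)) \<le> c" using K[OF \<open>K \<le> n\<close>] by simp
    then show "A (int n) \<le> nat \<lceil>c\<rceil>" by linarith
  qed
  note rec = eventually_recurrent[OF this]
  obtain m where "2 * (1 / 2 :: real) ^ m < (b - c) / 2"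
    using small_power_half[of "(b - c) / 2"] c by auto
  then have m: "4 * (1 / 2 :: real) ^ m < b - c" by simp
  define L where "L = 2 * m + 1"
  define W where "W = recurrent_windows L A"
  have L: "0 < L" by (simp add: L_def)
  obtain M where M: "\<forall>n\<ge>M. window L A (int n) \<in> W" using rec(2)[of L] unfolding W_def by blast
  have ext: "extendable L W" "extendable L (rev ` W)"
    using recurrent_extendable[OF A L rec(1)] M unfolding W_def by blast+
  have pos: "0 < X i" if "window L X i \<in> W" for X i
  proof -
    have "X i \<in> set (window L X i)" using L window_nth[OF L, of X i] by (metis length_window nth_mem add.right_neutral of_nat_0)
    then show ?thesis using ext(1) that by (auto simp: extendable_def)
  qed
  \<comment> \<open>The window of \<open>X\<close> around \<open>i\<close> occurs late in
    \<open>A\<close>, where the value is below \<open>c\<close>; agreement on it costs less than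
    \<open>b - c\<close>.\<close>
  have below_b: "bi_lambda X i < b" if X: "\<forall>i. window L X i \<in> W" for X i
  proof -
    obtain n where n: "K \<le> n" "window L A (int n) = window L X (i - int m)"
      using X unfolding W_def recurrent_windows_def by blast
    have "\<bar>bi_lambda X i - bi_lambda A (int (n + m))\<bar> \<le> 4 * (1 / 2) ^ m"
    proof (rule bi_lambda_agree)
      fix k assume "\<bar>k\<bar> \<le> int m"
      then have "A (int n + (k + int m)) = X (i - int m + (k + int m))"
        by (intro n(2)[unfolded window_eq_iff, rule_format]) (auto simp: L_def)
      then show "X (i + k) = A (int (n + m) + k)" by (simp add: algebra_simps)
    qed (use A pos X in auto)
    moreover have "bi_lambda A (int (n + m)) < c" using n(1) by (intro K) simp
    ultimately show ?thesis using m by linarith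
  qed
  have le_a: "bi_lambda X i \<le> a" if X: "\<forall>i. window L X i \<in> W" for X i
  proof -
    \<comment> \<open>After a shift only index 0 matters. A periodic sequence in the class agreeing
      with \<open>Z\<close> near 0 approximates its value.\<close>
    have zero: "bi_lambda Z 0 \<le> a" if Z: "\<forall>i. window L Z i \<in> W" for Z
    proof (rule field_le_epsilon)
      fix e :: real assume "0 < e"
      then obtain N where "2 * (1 / 2 :: real) ^ N < e / 2" using small_power_half[of "e / 2"] by auto
      then have N: "4 * (1 / 2 :: real) ^ N < e" by simp
      obtain P T where P: "0 < T" "\<forall>k. P (k + int T) = P k" "\<forall>i. window L P i \<in> W"
        "\<forall>k. \<bar>k\<bar> \<le> int N \<longrightarrow> P k = Z k"
        using periodic_closing[OF L M[unfolded W_def] Z[unfolded W_def], of N, folded W_def] by metis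
      have "\<forall>i. 0 < P i" using pos P(3) by blast
      from bi_M_periodic_in_spectrum[OF this P(1)] P(2) obtain i
        where i: "\<forall>j. bi_lambda P j \<le> bi_lambda P i" "bi_lambda P i \<in> lagrange_spectrum"
        by blast
      have "bi_lambda P i < b" using below_b P(3) by blast
      \<comment> \<open>The gap enters here: a value in the spectrum and below \<open>b\<close>
        cannot exceed \<open>a\<close>.\<close>
      then have "bi_lambda P i \<le> a" using gap i(2) by force
      then have "bi_lambda P 0 \<le> a" using i(1)[rule_format, of 0] by simp
      moreover have "\<bar>bi_lambda Z 0 - bi_lambda P 0\<bar> \<le> 4 * (1 / 2) ^ N"
        using pos P(3,4) Z by (intro bi_lambda_agree) auto
      ultimately show "bi_lambda Z 0 \<le> a + e" using N by linarith
    qed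
    have "window L (\<lambda>k. X (i + k)) j = window L X (i + j)" for j
      by (simp add: window_def add.assoc)
    then have "\<forall>j. window L (\<lambda>k. X (i + k)) j \<in> W" using X by simp
    from zero[OF this] show ?thesis by (simp add: bi_lambda_shift)
  qed
  have "\<exists>w\<in>W. a \<le> bi_lambda (greedy_bi W m w) 0"
  proof (rule ccontr)
    assume neg: "\<not> (\<exists>w\<in>W. a \<le> bi_lambda (greedy_bi W m w) 0)"
    \<comment> \<open>If all the finitely many greedy values were below \<open>a\<close>, so would
      be their maximum \<open>v\<close>, and late values of \<open>A\<close> could not exceed (a +
      v) / 2.\<close>
    define v where "v = Max ((\<lambda>w. bi_lambda (greedy_bi W m w) 0) ` W)"
    have fin: "finite ((\<lambda>w. bi_lambda (greedy_bi W m w) 0) ` W)"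
      using ext(1) by (simp add: extendable_def)
    have "W \<noteq> {}" using M by blast
    then have "v < a" using neg fin by (auto simp: v_def)
    then obtain N where "2 * (1 / 2 :: real) ^ N < (a - v) / 4" using small_power_half[of "(a - v) / 4"] by auto
    then have N: "4 * (1 / 2 :: real) ^ N < (a - v) / 2" by simp
    \<comment> \<open>The bound on \<open>n\<close> puts the leftmost window in the comparison, at
      \<open>n - m - N\<close>, at or beyond \<open>M\<close>.\<close>
    have "ereal (bi_lambda A (int n)) \<le> ereal ((a + v) / 2)" if n: "M + m + N \<le> n" for n
    proof -
      define w where "w = window L A (int n - int m)"
      have win: "window L A i \<in> W" if "int n - int m - int N \<le> i" for i
        using M[rule_format, of "nat i"] that n by simp
      then have w: "w \<in> W" by (simp add: w_def)
      have "bi_lambda A (int n) \<le> bi_lambda (greedy_bi W m w) 0 + 4 * (1 / 2) ^ N"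
        by (rule greedy_bi_optimal[OF ext w L_def A]) (use win w_def in auto)
      moreover have "bi_lambda (greedy_bi W m w) 0 \<le> v" unfolding v_def using fin w by (intro Max_ge) auto
      ultimately show ?thesis using N by simp
    qed
    then have "limsup (\<lambda>n. ereal (bi_lambda A (int n))) \<le> ereal ((a + v) / 2)"
      by (intro Limsup_bounded) (auto simp: eventually_sequentially)
    then show False using lim \<open>v < a\<close> by simp
  qed
  then obtain w where w: "w \<in> W" "a \<le> bi_lambda (greedy_bi W m w) 0" by blast
  let ?X = "greedy_bi W m w"
  have X: "\<forall>i. window L ?X i \<in> W" using greedy_bi_window[OF ext w(1) L_def] by blast
  have Xpos: "\<forall>i. 0 < ?X i" using pos X by blast
  have per: "eventually_periodic ?X" by (rule greedy_bi_eventually_periodic[OF ext w(1) L_def])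
  have eq: "a = bi_lambda ?X 0" using le_a[OF X, of 0] w(2) by simp
  have "bi_M ?X = ereal a"
    unfolding bi_M_def
  proof (rule antisym)
    show "(SUP i. ereal (bi_lambda ?X i)) \<le> ereal a" using le_a[OF X] by (intro SUP_least) simp
    show "ereal a \<le> (SUP i. ereal (bi_lambda ?X i))" by (subst eq) (rule SUP_upper, simp)
  qed
  then show ?thesis using Xpos per eq bi_lambda_quadratic[OF Xpos per] by metis
qed

end
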